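(* Suppose $\Phi$ is a non-degenerate SPN whose input variables (the elements $x_1,\dots,x_n$ of $x$) are all non-trivial. Then the following three conditions are equivalent: 1. $\Phi$ is strongly valid; 2. $\Phi$ is decomposable and complete; 3. $\Phi$'s output polynomial $q_\Phi$ is set-multilinear (with respect to the partition of the elements of $f$ into $f_1,\dots,f_n$).
   Context: Arithmetic circuits: an arithmetic circuit $\Phi$ over a tuple of variables $y$ is a finite directed acyclic graph with a unique node of out-degree $0$ (the root). Each node of in-degree $0$ is labeled by a variable of $y$ or a real constant; every other node is labeled $\times$ (product node) or $+$ (sum node), and edges into sum nodes carry real weights. The children $C(u)$ of $u$ are the nodes with an edge into $u$. Labeled leaves compute their labels, a product node computes $q_u=\prod_{v\in C(u)}q_v$, a sum node computes $q_u=\sum_{v\in C(u)}w_{v,u}q_v$; $q_\Phi$ is the polynomial in $y$ computed by the root. $\Phi$ is monotone if all weights and constants are non-negative, and a monotone circuit is non-degenerate if all its weights and constants are non-zero (i.e. strictly positive). SPNs: let $x=(x_1,\dots,x_n)$, $x_i\in R_i\subseteq\mathbb{R}$, with measures $M_i$ on $R_i$. For each $i$ let $f_i=(f_{i,1},\dots,f_{i,m_i})$ be a tuple of non-negative real-valued functions of $x_i$, each with finite $M_i$-integral over $R_i$; $f$ is the concatenation of the $f_i$. A Sum Product Network (SPN) is a monotone arithmetic circuit over $f$ (the $f_{i,j}$ regarded as formal variables); it computes the function $x\mapsto q_\Phi(f(x))$. The dependency-scope of a node $u$ is the set of those $x_i$ such that some $f_{i,j}$ labels a node in the sub-circuit rooted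 at $u$. $\Phi$ is decomposable if for every product node the dependency-scopes of its children are pairwise disjoint, and complete if for every sum node the dependency-scopes of its children are all the same. Validity: $\Phi$ is valid if for every $I=\{i_1,\dots,i_\ell\}\subseteq\{1,\dots,n\}$, all subsets $S_i\subseteq R_i$ for $i\in I$, and every fixed value of $(x_i)_{i\notin I}$, $$\int_{\prod_{i\in I}S_i}q_\Phi(f(x))\,d\Big(\prod_{i\in I}M_i\Big)(x_I)=q_\Phi(A),$$ where $A$ is obtained from $f$ by replacing $f_{i,j}$ by $\int_{S_i}f_{i,j}\,dM_i$ for $i\in I$ and by $f_{i,j}(x_i)$ for $i\notin I$. $\Phi$ is strongly valid if it is valid for every possible choice of the univariate functions making up $f$ (only the values computed by each $f_{i,j}$ vary, not which variable $x_i$ it depends on). A variable $x_i$ is non-trivial if there are at least two disjoint subsets of $R_i$ which have finite and non-zero measure under $M_i$. Set-multilinearity: the scope of a polynomial in $f$ is the set of variables $f_{i,j}$ occurring in its monomials with non-zero coefficient; its set-scope is the collection of those $f_i$ that meet its scope. A polynomial in $f$ is set-multilinear if each of its monomials has exactly one factor (counted with multiplicity) from each $f_i$ in its set-scope.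
   Formalization: Adds the assumption that Φ depends on every x_i (the dependency-scope of its root is all of x_1,…,x_n); without it a positive constant circuit with n = 1 satisfies 2 and 3 but not 1. The subsets S_i and those in "non-trivial" are taken to be measurable. *)

theory Defs
  imports "HOL-Analysis.Analysis" "HOL-Library.Poly_Mapping"
begin

subsection \<open>Multivariate polynomials\<close>

text \<open>A monomial is a finitely supported exponent map, a polynomial a finitely supported map from
  monomials to coefficients; multiplication on \<^typ>\<open>('y \<Rightarrow>\<^sub>0 nat) \<Rightarrow>\<^sub>0 real\<close> is the convolution product.\<close>

type_synonym 'y mpoly = "('y \<Rightarrow>\<^sub>0 nat) \<Rightarrow>\<^sub>0 real"

definition mpoly_var :: "'y \<Rightarrow> 'y mpoly" where
  "mpoly_var y = Poly_Mapping.single (Poly_Mapping.single y 1) 1"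

definition mpoly_const :: "real \<Rightarrow> 'y mpoly" where
  "mpoly_const c = Poly_Mapping.single 0 c"

definition mpoly_eval :: "('y \<Rightarrow> real) \<Rightarrow> 'y mpoly \<Rightarrow> real" where
  "mpoly_eval a p =
     (\<Sum>\<mu>\<in>Poly_Mapping.keys p. Poly_Mapping.lookup p \<mu> *
        (\<Prod>y\<in>Poly_Mapping.keys \<mu>. a y ^ Poly_Mapping.lookup \<mu> y))"

definition mpoly_scope :: "'y mpoly \<Rightarrow> 'y set" where
  "mpoly_scope p = (\<Union>\<mu>\<in>Poly_Mapping.keys p. Poly_Mapping.keys \<mu>)"


subsection \<open>Arithmetic circuits\<close>

datatype 'y gate = VarLeaf 'y | ConstLeaf real | ProdGate | SumGate

text \<open>An edge \<^term>\<open>(v, u)\<close> points from the child \<^term>\<open>v\<close> to the parent \<^term>\<open>u\<close>. Only the weights of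
  edges into sum nodes are meaningful.\<close>

record ('v, 'y) circuit =
  nodes :: "'v set"
  edges :: "('v \<times> 'v) set"
  gate_of :: "'v \<Rightarrow> 'y gate"
  weight :: "'v \<times> 'v \<Rightarrow> real"

definition children :: "('v, 'y) circuit \<Rightarrow> 'v \<Rightarrow> 'v set" where
  "children \<Phi> u = {v. (v, u) \<in> edges \<Phi>}"

definition is_root :: "('v, 'y) circuit \<Rightarrow> 'v \<Rightarrow> bool" where
  "is_root \<Phi> r \<longleftrightarrow> r \<in> nodes \<Phi> \<and> (\<forall>w. (r, w) \<notin> edges \<Phi>)"

definition circuit_root :: "('v, 'y) circuit \<Rightarrow> 'v" where
  "circuit_root \<Phi> = (THE r. is_root \<Phi> r)"

definition arithmetic_circuit :: "'y set \<Rightarrow> ('v, 'y) circuit \<Rightarrow> bool" where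
  "arithmetic_circuit Y \<Phi> \<longleftrightarrow>
     finite (nodes \<Phi>) \<and> edges \<Phi> \<subseteq> nodes \<Phi> \<times> nodes \<Phi> \<and> acyclic (edges \<Phi>) \<and>
     (\<exists>!r. is_root \<Phi> r) \<and>
     (\<forall>u\<in>nodes \<Phi>.
        if children \<Phi> u = {}
        then (\<exists>y\<in>Y. gate_of \<Phi> u = VarLeaf y) \<or> (\<exists>c. gate_of \<Phi> u = ConstLeaf c)
        else gate_of \<Phi> u = ProdGate \<or> gate_of \<Phi> u = SumGate)"

text \<open>The recursion equation satisfied by \<open>node_poly\<close> on circuits is \<open>node_poly_unfold\<close> below.\<close>

definition node_poly :: "('v, 'y) circuit \<Rightarrow> 'v \<Rightarrow> 'y mpoly" where
  "node_poly \<Phi> = wfrec (edges \<Phi>) (\<lambda>q u.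
     case gate_of \<Phi> u of
       VarLeaf y \<Rightarrow> mpoly_var y
     | ConstLeaf c \<Rightarrow> mpoly_const c
     | ProdGate \<Rightarrow> (\<Prod>v\<in>children \<Phi> u. q v)
     | SumGate \<Rightarrow> (\<Sum>v\<in>children \<Phi> u. mpoly_const (weight \<Phi> (v, u)) * q v))"

lemma node_poly_unfold:
  assumes "arithmetic_circuit Y \<Phi>"
  shows "node_poly \<Phi> u =
    (case gate_of \<Phi> u of
       VarLeaf y \<Rightarrow> mpoly_var y
     | ConstLeaf c \<Rightarrow> mpoly_const c
     | ProdGate \<Rightarrow> (\<Prod>v\<in>children \<Phi> u. node_poly \<Phi> v)
     | SumGate \<Rightarrow> (\<Sum>v\<in>children \<Phi> u. mpoly_const (weight \<Phi> (v, u)) * node_poly \<Phi> v))"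
proof -
  have "finite (edges \<Phi>)"
    using assms by (auto simp: arithmetic_circuit_def intro: finite_subset)
  then have "wf (edges \<Phi>)"
    using assms by (simp add: arithmetic_circuit_def finite_acyclic_wf)
  then show ?thesis
    unfolding node_poly_def
    by (subst wfrec, assumption)
       (auto simp: children_def cut_apply split: gate.split intro!: prod.cong sum.cong)
qed

definition circuit_poly :: "('v, 'y) circuit \<Rightarrow> 'y mpoly" where
  "circuit_poly \<Phi> = node_poly \<Phi> (circuit_root \<Phi>)"

definition monotone_circuit :: "('v, 'y) circuit \<Rightarrow> bool" where
  "monotone_circuit \<Phi> \<longleftrightarrow>
     (\<forall>u\<in>nodes \<Phi>. \<forall>c. gate_of \<Phi> u = ConstLeaf c \<longrightarrow> 0 \<le> c) \<and>
     (\<forall>(v, u)\<in>edges \<Phi>. gate_of \<Phi> u = SumGate \<longrightarrow> 0 \<le> weight \<Phi> (v, u))"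

definition non_degenerate :: "('v, 'y) circuit \<Rightarrow> bool" where
  "non_degenerate \<Phi> \<longleftrightarrow>
     (\<forall>u\<in>nodes \<Phi>. \<forall>c. gate_of \<Phi> u = ConstLeaf c \<longrightarrow> c \<noteq> 0) \<and>
     (\<forall>(v, u)\<in>edges \<Phi>. gate_of \<Phi> u = SumGate \<longrightarrow> weight \<Phi> (v, u) \<noteq> 0)"


subsection \<open>Sum product networks\<close>

text \<open>The input variables are indexed by \<^term>\<open>{1..n::nat}\<close>, the range \<open>R\<^sub>i\<close> of the \<open>i\<close>-th one is
  \<^term>\<open>space (M i)\<close>, and \<open>f\<^sub>i\<close> has the entries \<open>f i 1, \<dots>, f i (m i)\<close>. As a formal variable, the
  function \<open>f i j\<close> is the pair \<open>(i, j)\<close>.\<close>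

definition formal_vars :: "nat \<Rightarrow> (nat \<Rightarrow> nat) \<Rightarrow> (nat \<times> nat) set" where
  "formal_vars n m = (SIGMA i:{1..n}. {1..m i})"

definition admissible ::
  "nat \<Rightarrow> (nat \<Rightarrow> real measure) \<Rightarrow> (nat \<Rightarrow> nat) \<Rightarrow> (nat \<Rightarrow> nat \<Rightarrow> real \<Rightarrow> real) \<Rightarrow> bool" where
  "admissible n M m f \<longleftrightarrow>
     (\<forall>(i, j)\<in>formal_vars n m. (\<forall>t\<in>space (M i). 0 \<le> f i j t) \<and> integrable (M i) (f i j))"

definition SPN ::
  "nat \<Rightarrow> (nat \<Rightarrow> real measure) \<Rightarrow> (nat \<Rightarrow> nat) \<Rightarrow> (nat \<Rightarrow> nat \<Rightarrow> real \<Rightarrow> real) \<Rightarrow>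
   ('v, nat \<times> nat) circuit \<Rightarrow> bool" where
  "SPN n M m f \<Phi> \<longleftrightarrow>
     admissible n M m f \<and> arithmetic_circuit (formal_vars n m) \<Phi> \<and> monotone_circuit \<Phi>"

definition dependency_scope :: "('v, nat \<times> nat) circuit \<Rightarrow> 'v \<Rightarrow> nat set" where
  "dependency_scope \<Phi> u = {i. \<exists>w j. (w, u) \<in> (edges \<Phi>)\<^sup>* \<and> gate_of \<Phi> w = VarLeaf (i, j)}"

definition decomposable :: "('v, nat \<times> nat) circuit \<Rightarrow> bool" where
  "decomposable \<Phi> \<longleftrightarrow>
     (\<forall>u\<in>nodes \<Phi>. gate_of \<Phi> u = ProdGate \<longrightarrow>
        (\<forall>v\<in>children \<Phi> u. \<forall>w\<in>children \<Phi> u. v \<noteq> w \<longrightarrow>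
           dependency_scope \<Phi> v \<inter> dependency_scope \<Phi> w = {}))"

definition complete_circuit :: "('v, nat \<times> nat) circuit \<Rightarrow> bool" where
  "complete_circuit \<Phi> \<longleftrightarrow>
     (\<forall>u\<in>nodes \<Phi>. gate_of \<Phi> u = SumGate \<longrightarrow>
        (\<forall>v\<in>children \<Phi> u. \<forall>w\<in>children \<Phi> u.
           dependency_scope \<Phi> v = dependency_scope \<Phi> w))"

text \<open>The integrand is non-negative, so its integral is taken in \<open>[0, \<infinity>]\<close> (a Bochner integral would
  silently be 0 for a non-integrable integrand). The point \<open>x\<close> supplies the fixed coordinates
  outside \<open>I\<close>; its coordinates in \<open>I\<close> are irrelevant. Since \<open>I\<close> ranges over all of \<^term>\<open>{1..n}\<close>, a valid circuit must depend on every
  input variable: for an absent one, integration contributes a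
  factor \<open>M\<^sub>i(S\<^sub>i)\<close> on the left-hand side only. This is why the equivalence of strong
  validity with decomposability and completeness needs the
  dependency-scope of the root to be all of \<^term>\<open>{1..n}\<close>.\<close>

definition valid ::
  "nat \<Rightarrow> (nat \<Rightarrow> real measure) \<Rightarrow> (nat \<Rightarrow> nat \<Rightarrow> real \<Rightarrow> real) \<Rightarrow>
   ('v, nat \<times> nat) circuit \<Rightarrow> bool" where
  "valid n M f \<Phi> \<longleftrightarrow>
     (\<forall>I S x. I \<subseteq> {1..n} \<longrightarrow> (\<forall>i\<in>I. S i \<in> sets (M i)) \<longrightarrow> (\<forall>i\<in>{1..n} - I. x i \<in> space (M i)) \<longrightarrow>
        (\<integral>\<^sup>+z\<in>(\<Pi>\<^sub>E i\<in>I. S i).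
            ennreal (mpoly_eval (\<lambda>(i, j). f i j (if i \<in> I then z i else x i)) (circuit_poly \<Phi>))
          \<partial>(PiM I M))
        = ennreal (mpoly_eval
            (\<lambda>(i, j). if i \<in> I then (LINT t:S i|M i. f i j t) else f i j (x i))
            (circuit_poly \<Phi>)))"

definition strongly_valid ::
  "nat \<Rightarrow> (nat \<Rightarrow> real measure) \<Rightarrow> (nat \<Rightarrow> nat) \<Rightarrow> ('v, nat \<times> nat) circuit \<Rightarrow> bool" where
  "strongly_valid n M m \<Phi> \<longleftrightarrow> (\<forall>f. admissible n M m f \<longrightarrow> valid n M f \<Phi>)"

definition nontrivial_variable :: "real measure \<Rightarrow> bool" where
  "nontrivial_variable N \<longleftrightarrow>
     (\<exists>A\<in>sets N. \<exists>B\<in>sets N. A \<inter> B = {} \<and>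
        0 < emeasure N A \<and> emeasure N A < \<infinity> \<and> 0 < emeasure N B \<and> emeasure N B < \<infinity>)"


subsection \<open>Set-multilinear polynomials\<close>

definition set_scope :: "(nat \<times> nat) mpoly \<Rightarrow> nat set" where
  "set_scope p = {i. \<exists>j. (i, j) \<in> mpoly_scope p}"

definition set_multilinear :: "(nat \<Rightarrow> nat) \<Rightarrow> (nat \<times> nat) mpoly \<Rightarrow> bool" where
  "set_multilinear m p \<longleftrightarrow>
     (\<forall>\<mu>\<in>Poly_Mapping.keys p. \<forall>i\<in>set_scope p. (\<Sum>j=1..m i. Poly_Mapping.lookup \<mu> (i, j)) = 1)"

end

theory Submission
  imports Defs
begin

text \<open>Positivity rules out cancellation, so the monomials of a sum node are the union of those of its
  children, and the monomials of a product node are all products of monomials of its children. Let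
  the block degree of a monomial in \<open>i\<close> be its number of factors from \<open>f\<^sub>i\<close>.

  In a decomposable and complete circuit, induction shows that every monomial of a node has block
  degree 1 in the variables of the dependency-scope and 0 in the others. Conversely, every node
  reaches the root, so some fixed monomial multiplies all monomials of the node into monomials of
  the output. If the latter is set-multilinear, then all monomials of a node have the same block
  degrees, which are at most 1; this forces completeness and decomposability.

  If the output is set-multilinear, each of its monomials evaluates to a product of one function of each
  \<open>x\<^sub>i\<close>, and the integral of such a product over a rectangle factors. Conversely, fix \<open>i\<close>, let the functions
  of the other variables evaluate to 1 and let all \<open>f\<^sub>i\<^sub>,\<^sub>j\<close> be one function whose integral over each of two
  disjoint sets is \<open>s\<close>. Then the output becomes a univariate polynomial \<open>P\<close> with positive coefficients, and
  additivity of the integral gives \<open>P (2 * s) = 2 * P s\<close>. At \<open>s = 0\<close> and \<open>s = 1\<close> this shows that all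
  exponents of \<open>P\<close> are 1.\<close>

subsection \<open>Products of arbitrary measures\<close>

text \<open>The identity of rectangle indicators is integrated one coordinate at a time; the weights \<open>c\<close> and
  \<open>d\<close> absorb the coordinates that are still fixed.\<close>

lemma suminf_prod_emeasure:
  fixes c :: "nat \<Rightarrow> ennreal" and d :: ennreal
  assumes "finite I"
    and "\<And>k i. i \<in> I \<Longrightarrow> X k i \<in> sets (M i)"
    and "\<And>i. i \<in> I \<Longrightarrow> Y i \<in> sets (M i)"
    and "\<And>z. z \<in> (\<Pi>\<^sub>E i\<in>I. space (M i)) \<Longrightarrow>
      suminf (\<lambda>k. c k * (\<Prod>i\<in>I. indicator (X k i) (z i))) = d * (\<Prod>i\<in>I. indicator (Y i) (z i))"
  shows "suminf (\<lambda>k. c k * (\<Prod>i\<in>I. emeasure (M i) (X k i))) = d * (\<Prod>i\<in>I. emeasure (M i) (Y i))"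
  using assms
proof (induction I arbitrary: c d rule: finite_induct)
  case empty
  then show ?case by (auto simp: PiE_empty_domain)
next
  case (insert i F)
  have fixed: "suminf (\<lambda>k. (c k * indicator (X k i) t) * (\<Prod>j\<in>F. emeasure (M j) (X k j)))
      = (d * indicator (Y i) t) * (\<Prod>j\<in>F. emeasure (M j) (Y j))"
    if t: "t \<in> space (M i)" for t
  proof (rule insert.IH)
    fix z assume z: "z \<in> (\<Pi>\<^sub>E i\<in>F. space (M i))"
    have upd: "(\<Prod>j\<in>F. indicator (Z j) (if j = i then t else z j)) = (\<Prod>j\<in>F. indicator (Z j) (z j) :: ennreal)"
      for Z using insert.hyps(2) by (intro prod.cong) auto
    have "z(i := t) \<in> (\<Pi>\<^sub>E i\<in>insert i F. space (M i))"
      using z t by (auto simp: PiE_iff extensional_def)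
    from insert.prems(3)[OF this] insert.hyps
    show "suminf (\<lambda>k. (c k * indicator (X k i) t) * (\<Prod>j\<in>F. indicator (X k j) (z j)))
        = (d * indicator (Y i) t) * (\<Prod>j\<in>F. indicator (Y j) (z j))"
      by (simp add: upd mult.assoc)
  qed (use insert.prems in auto)
  have [measurable]: "X k i \<in> sets (M i)" "Y i \<in> sets (M i)" for k
    using insert.prems by auto
  \<comment> \<open>Only coordinate \<open>i\<close> is integrated here. Exchanging sum and integral
    over the single measure \<open>M i\<close> is monotone convergence, which requires no
    sigma-finiteness.\<close>
  have "suminf (\<lambda>k. c k * (\<Prod>j\<in>insert i F. emeasure (M j) (X k j)))
      = suminf (\<lambda>k. \<integral>\<^sup>+t. (c k * indicator (X k i) t) * (\<Prod>j\<in>F. emeasure (M j) (X k j)) \<partial>M i)"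
    using insert.hyps
    by (simp add: nn_integral_cmult nn_integral_multc nn_integral_cmult_indicator mult_ac)
  also have "\<dots> = (\<integral>\<^sup>+t. suminf (\<lambda>k. (c k * indicator (X k i) t) * (\<Prod>j\<in>F. emeasure (M j) (X k j))) \<partial>M i)"
    by (rule nn_integral_suminf[symmetric]) measurable
  also have "\<dots> = (\<integral>\<^sup>+t. (d * indicator (Y i) t) * (\<Prod>j\<in>F. emeasure (M j) (Y j)) \<partial>M i)"
    by (intro nn_integral_cong fixed)
  also have "\<dots> = d * (\<Prod>j\<in>insert i F. emeasure (M j) (Y j))"
    using insert.hyps
    by (simp add: nn_integral_cmult nn_integral_multc nn_integral_cmult_indicator mult_ac)
  finally show ?case .
qed

text \<open>Membership in a \<open>PiE\<close> set also demands extensionality, which the coordinate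
  indicators cannot detect; hence the second hypothesis.\<close>

lemma prod_indicator_PiE:
  assumes "finite I" "z \<in> extensional I"
  shows "(\<Prod>i\<in>I. indicator (X i) (z i)) = (indicator (\<Pi>\<^sub>E i\<in>I. X i) z :: ennreal)"
proof (cases "z \<in> (\<Pi>\<^sub>E i\<in>I. X i)")
  case True
  then show ?thesis by (auto simp: PiE_iff intro!: prod.neutral)
next
  case False
  then obtain i where "i \<in> I" "z i \<notin> X i" using assms by (auto simp: PiE_iff)
  then have "(\<Prod>i\<in>I. indicator (X i) (z i)) = (0 :: ennreal)"
    using assms(1) by (intro prod_zero) (auto intro!: bexI[of _ i])
  then show ?thesis using False by simp
qed

text \<open>This is the set-theoretic input for Caratheodory's theorem: a difference of rectangles
  is a finite disjoint union of rectangles. For \<open>I = {}\<close> the only rectangle is a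
  singleton, so the empty set would be missing.\<close>

lemma semiring_of_sets_PiE:
  assumes "finite I" "I \<noteq> {}"
  shows "semiring_of_sets (\<Pi>\<^sub>E i\<in>I. space (M i)) {Pi\<^sub>E I X |X. \<forall>i\<in>I. X i \<in> sets (M i)}"
    (is "semiring_of_sets _ ?R")
proof unfold_locales
  show "?R \<subseteq> Pow (\<Pi>\<^sub>E i\<in>I. space (M i))"
    by (auto simp: PiE_iff dest: sets.sets_into_space)
  have "Pi\<^sub>E I (\<lambda>_. {}) = {}" using assms(2) by (auto simp: PiE_eq_empty_iff)
  then show "{} \<in> ?R" by (intro CollectI exI[of _ "\<lambda>_. {}"]) auto
  fix a b assume "a \<in> ?R" "b \<in> ?R"
  then obtain X Y where XY: "a = Pi\<^sub>E I X" "b = Pi\<^sub>E I Y"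
      "\<forall>i\<in>I. X i \<in> sets (M i)" "\<forall>i\<in>I. Y i \<in> sets (M i)"
    by auto
  then have "a \<inter> b = Pi\<^sub>E I (\<lambda>i. X i \<inter> Y i)" "\<forall>i\<in>I. X i \<inter> Y i \<in> sets (M i)"
    by (auto simp: PiE_iff)
  then show "a \<inter> b \<in> ?R" by blast
  \<comment> \<open>\<open>P T\<close> collects the points of \<open>a\<close> that violate \<open>b\<close> exactly in the coordinates \<open>T\<close>.\<close>
  define P where "P T = Pi\<^sub>E I (\<lambda>i. if i \<in> T then X i - Y i else X i \<inter> Y i)" for T
  define C where "C = P ` (Pow I - {{}})"
  have "C \<subseteq> ?R" using XY by (auto simp: C_def P_def)
  moreover have "finite C" using assms by (simp add: C_def)
  moreover have "disjoint C"
  proof -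
    \<comment> \<open>The index set \<open>T\<close> can be read off from any point of
      \<open>P T\<close>, so distinct pieces are disjoint.\<close>
    have "T = {i\<in>I. z i \<notin> Y i}" if "T \<subseteq> I" "z \<in> P T" for T z
      using that by (auto simp: P_def PiE_iff split: if_splits)
    then have "P T \<inter> P T' = {}" if "T \<subseteq> I" "T' \<subseteq> I" "P T \<noteq> P T'" for T T'
      using that by blast
    then show ?thesis unfolding C_def disjoint_def by blast
  qed
  moreover have "a - b = \<Union> C"
  proof (intro equalityI subsetI)
    fix z assume z: "z \<in> a - b"
    then have "{i\<in>I. z i \<notin> Y i} \<in> Pow I - {{}}" using XY by (auto simp: PiE_iff)
    moreover have "z \<in> P {i\<in>I. z i \<notin> Y i}" using z XY by (auto simp: P_def PiE_iff)
    ultimately show "z \<in> \<Union> C" by (auto simp: C_def)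
  next
    fix z assume "z \<in> \<Union> C"
    then obtain T where T: "T \<subseteq> I" "T \<noteq> {}" "z \<in> P T" by (auto simp: C_def)
    then obtain i where "i \<in> T" by auto
    with T(1) have "i \<in> I" by blast
    with T(3) \<open>i \<in> T\<close> have "z i \<notin> Y i" by (auto simp: P_def PiE_iff)
    moreover have "z \<in> Pi\<^sub>E I X" using T by (auto simp: P_def PiE_iff split: if_splits)
    ultimately show "z \<in> a - b" using XY \<open>i \<in> I\<close> by (auto simp: PiE_iff)
  qed
  ultimately show "\<exists>C\<subseteq>?R. finite C \<and> disjoint C \<and> a - b = \<Union> C" by blast
qed

text \<open>The library has this only for \<open>\<sigma>\<close>-finite factors, where the product measure is unique. Without
  that assumption an extension of the rectangle function still exists by Caratheodory's theorem, and
  \<^const>\<open>PiM\<close> denotes some such extension.\<close>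

proposition emeasure_PiM_PiE:
  assumes I: "finite I" and X: "\<And>i. i \<in> I \<Longrightarrow> X i \<in> sets (M i)"
  shows "emeasure (PiM I M) (Pi\<^sub>E I X) = (\<Prod>i\<in>I. emeasure (M i) (X i))"
proof (cases "I = {}")
  case True
  then show ?thesis by (simp add: PiM_empty PiE_empty_domain)
next
  case False
  define ext where "ext J X = (\<lambda>i. if i \<in> J then X i else space (M i))" for J X
  \<comment> \<open>\<open>P\<close>, \<open>G\<close> and \<open>\<mu>\<close> repeat the data in
    the definition of \<open>PiM\<close>: rectangles given by sides on \<open>J\<close> only.
    \<open>ext\<close> fills the other sides with the full spaces.\<close>
  define P where "P J X \<longleftrightarrow> (J \<noteq> {} \<or> I = {}) \<and> finite J \<and> J \<subseteq> I \<and> X \<in> (\<Pi> j\<in>J. sets (M j))" for J X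
  define G where "G J X = prod_emb I M J (\<Pi>\<^sub>E j\<in>J. X j)" for J X
  define \<mu> where "\<mu> J X = (\<Prod>j\<in>J \<union> {i\<in>I. emeasure (M i) (space (M i)) \<noteq> 1}.
      if j \<in> J then emeasure (M j) (X j) else emeasure (M j) (space (M j)))" for J X
  have G: "G J X = Pi\<^sub>E I (ext J X)" if "P J X" for J X
    using that by (auto simp: prod_emb_Pi ext_def P_def G_def)
  have ext_sets: "\<forall>i\<in>I. ext J X i \<in> sets (M i)" if "P J X" for J X
    using that by (auto simp: ext_def P_def)
  have \<mu>: "\<mu> J X = (\<Prod>i\<in>I. emeasure (M i) (ext J X i))" if "P J X" for J X
  proof -
    have "\<mu> J X = (\<Prod>j\<in>I. if j \<in> J then emeasure (M j) (X j) else emeasure (M j) (space (M j)))"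
      \<comment> \<open>The coordinates outside the index set of \<open>\<mu>\<close> have total
        measure 1, so adding them changes nothing.\<close>
      unfolding \<mu>_def using that I by (intro prod.mono_neutral_left) (auto simp: P_def)
    then show ?thesis by (simp add: ext_def if_distrib)
  qed
  have null: "(\<Prod>i\<in>I. emeasure (M i) (Y i)) = 0" if "Pi\<^sub>E I Y = {}" for Y
  proof -
    from that obtain i where "i \<in> I" "emeasure (M i) (Y i) = 0"
      by (auto simp: PiE_eq_empty_iff)
    then show ?thesis using I by (intro prod_zero) auto
  qed
  have PI: "P I X" if "\<forall>i\<in>I. X i \<in> sets (M i)" for X
    using that I by (auto simp: P_def)
  have extI: "Pi\<^sub>E I (ext I X) = Pi\<^sub>E I X" for X
    by (intro PiE_cong) (simp add: ext_def)
  have rects: "{G J X |J X. P J X} = {Pi\<^sub>E I X |X. \<forall>i\<in>I. X i \<in> sets (M i)}"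
    (is "?L = ?R")
  proof (intro equalityI subsetI)
    fix S assume "S \<in> ?L"
    then obtain J X where JX: "S = G J X" "P J X" by blast
    show "S \<in> ?R" using G[OF JX(2)] ext_sets[OF JX(2)] JX(1) by blast
  next
    fix S assume "S \<in> ?R"
    then obtain X where X: "S = Pi\<^sub>E I X" "\<forall>i\<in>I. X i \<in> sets (M i)" by blast
    show "S \<in> ?L" using G[OF PI[OF X(2)]] PI[OF X(2)] X(1) extI by blast
  qed
  have "emeasure (PiM I M) (G I X) = \<mu> I X"
  proof (rule extend_measure_caratheodory_pair[where P = P and G = G and \<mu> = \<mu>])
    show "PiM I M = extend_measure (\<Pi>\<^sub>E i\<in>I. space (M i)) {(J, X). P J X} (\<lambda>(J, X). G J X) (\<lambda>(J, X). \<mu> J X)"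
      by (simp add: PiM_def P_def G_def \<mu>_def)
    show "P I X" using X PI by simp
    show "semiring_of_sets (\<Pi>\<^sub>E i\<in>I. space (M i)) {G J X |J X. P J X}"
      unfolding rects using semiring_of_sets_PiE[OF I False] .
  next
    fix J X assume "P J X" "G J X = {}"
    then show "\<mu> J X = 0" using G null \<mu> by metis
  next
    \<comment> \<open>The value must not depend on the presentation: a non-empty rectangle
      determines its sides, and an empty one has value 0 by \<open>null\<close>.\<close>
    fix J X K Y assume P: "P J X" "P K Y" and "G J X = G K Y"
    then have eq: "Pi\<^sub>E I (ext J X) = Pi\<^sub>E I (ext K Y)" using G by simp
    have "(\<Prod>i\<in>I. emeasure (M i) (ext J X i)) = (\<Prod>i\<in>I. emeasure (M i) (ext K Y i))"
    proof (cases "Pi\<^sub>E I (ext J X) = {}")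
      case True
      then show ?thesis using eq null by metis
    next
      case False
      then have "\<forall>i\<in>I. ext J X i = ext K Y i"
        using eq False[unfolded eq] unfolding PiE_eq_empty_iff
        by (subst (asm) PiE_eq_iff_not_empty) auto
      then show ?thesis by simp
    qed
    then show "\<mu> J X = \<mu> K Y" using \<mu> P by metis
  next
    fix A :: "nat \<Rightarrow> _" and B :: "nat \<Rightarrow> _" and K Y
    assume P: "\<And>n. P (A n) (B n)" "P K Y" and disj: "disjoint_family (\<lambda>n. G (A n) (B n))"
      and un: "(\<Union>n. G (A n) (B n)) = G K Y"
    \<comment> \<open>Disjointness and the union together say that the indicators add up pointwise.
      This is the hypothesis of \<open>suminf_prod_emeasure\<close> with all weights equal to
      1.\<close>
    have "suminf (\<lambda>n. 1 * (\<Prod>i\<in>I. emeasure (M i) (ext (A n) (B n) i)))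
        = 1 * (\<Prod>i\<in>I. emeasure (M i) (ext K Y i))"
    proof (rule suminf_prod_emeasure[OF I])
      fix z assume "z \<in> (\<Pi>\<^sub>E i\<in>I. space (M i))"
      then have z: "z \<in> extensional I" by (simp add: PiE_iff)
      show "suminf (\<lambda>n. 1 * (\<Prod>i\<in>I. indicator (ext (A n) (B n) i) (z i))) =
          1 * (\<Prod>i\<in>I. indicator (ext K Y i) (z i) :: ennreal)"
        using suminf_indicator[OF disj, of z] un
        by (simp add: prod_indicator_PiE[OF I z] G[OF P(1)] G[OF P(2)])
    qed (use ext_sets P in blast)+
    then show "suminf (\<lambda>n. \<mu> (A n) (B n)) = \<mu> K Y"
      by (simp only: \<mu>[OF P(1)] \<mu>[OF P(2)] mult_1)
  qed simp
  moreover have "G I X = Pi\<^sub>E I X" using G PI X extI by simp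
  moreover have "\<mu> I X = (\<Prod>i\<in>I. emeasure (M i) (X i))"
    using \<mu>[of I X] PI X by (simp add: ext_def)
  ultimately show ?thesis by simp
qed

text \<open>Fubini is avoided, since the factors need not be sigma-finite. Starting from the measure
  of a rectangle, its indicators are replaced by the functions \<open>g\<close> one coordinate at a
  time; \<open>J\<close> holds the coordinates already treated.\<close>

proposition nn_integral_PiM_prod:
  fixes g :: "'i \<Rightarrow> 'a \<Rightarrow> ennreal"
  assumes I: "finite I" and g: "\<And>i. i \<in> I \<Longrightarrow> g i \<in> borel_measurable (M i)"
  shows "(\<integral>\<^sup>+z. (\<Prod>i\<in>I. g i (z i)) \<partial>PiM I M) = (\<Prod>i\<in>I. \<integral>\<^sup>+t. g i t \<partial>M i)"
proof -
  have "(\<integral>\<^sup>+z. (\<Prod>i\<in>J. g i (z i)) * (\<Prod>i\<in>I-J. indicator (X i) (z i)) \<partial>PiM I M)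
      = (\<Prod>i\<in>J. \<integral>\<^sup>+t. g i t \<partial>M i) * (\<Prod>i\<in>I-J. emeasure (M i) (X i))"
    if J: "J \<subseteq> I" and X: "\<And>i. i \<in> I \<Longrightarrow> X i \<in> sets (M i)" for J X
    using finite_subset[OF J I] J X
  proof (induction J arbitrary: X rule: finite_induct)
    case empty
    have "(\<integral>\<^sup>+z. (\<Prod>i\<in>I. indicator (X i) (z i)) \<partial>PiM I M) = (\<integral>\<^sup>+z. indicator (Pi\<^sub>E I X) z \<partial>PiM I M)"
      by (intro nn_integral_cong prod_indicator_PiE[OF I]) (simp add: space_PiM PiE_iff)
    also have "\<dots> = emeasure (PiM I M) (Pi\<^sub>E I X)"
      using empty I by (intro nn_integral_indicator sets_PiM_I_finite) auto
    finally show ?case using empty by (simp add: emeasure_PiM_PiE[OF I])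
  next
    case (insert i J)
    define G where "G z = (\<Prod>j\<in>J. g j (z j)) * (\<Prod>j\<in>I-insert i J. indicator (X j) (z j))" for z
    define C where "C = (\<Prod>j\<in>J. \<integral>\<^sup>+t. g j t \<partial>M j) * (\<Prod>j\<in>I-insert i J. emeasure (M j) (X j))"
    have i: "i \<in> I" "i \<notin> J" "J \<subseteq> I" "I - J = insert i (I - insert i J)"
      using insert by auto
    have comp: "(\<lambda>z. h (z j)) \<in> borel_measurable (PiM I M)" if "j \<in> I" "h \<in> borel_measurable (M j)"
      for h :: "'a \<Rightarrow> ennreal" and j
      using that(1) by (intro measurable_compose[OF _ that(2)] measurable_component_singleton)
    have G[measurable]: "G \<in> borel_measurable (PiM I M)"
      unfolding G_def using insert.prems g
      by (intro borel_measurable_times_ennreal borel_measurable_prod_ennreal comp borel_measurable_indicator) auto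
    \<comment> \<open>\<open>G\<close> collects the factors of all other coordinates. Both sides are
      linear in \<open>h\<close> and continuous under monotone limits, so indicators suffice; for
      these the claim is the induction hypothesis with \<open>A\<close> as side
      \<open>i\<close>.\<close>
    have "(\<integral>\<^sup>+z. h (z i) * G z \<partial>PiM I M) = (\<integral>\<^sup>+t. h t \<partial>M i) * C" if "h \<in> borel_measurable (M i)" for h
      using that
    proof (induction h rule: borel_measurable_induct)
      case (cong f h)
      have "(\<integral>\<^sup>+z. f (z i) * G z \<partial>PiM I M) = (\<integral>\<^sup>+z. h (z i) * G z \<partial>PiM I M)"
        using i(1) cong.hyps(3) by (intro nn_integral_cong) (auto simp: space_PiM PiE_iff)
      also have "\<dots> = (\<integral>\<^sup>+t. h t \<partial>M i) * C" by fact
      also have "(\<integral>\<^sup>+t. h t \<partial>M i) = (\<integral>\<^sup>+t. f t \<partial>M i)"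
        by (rule nn_integral_cong) (simp add: cong.hyps(3))
      finally show ?case .
    next
      case (set A)
      have "(\<integral>\<^sup>+z. (\<Prod>j\<in>J. g j (z j)) * (\<Prod>j\<in>I-J. indicator ((X(i := A)) j) (z j)) \<partial>PiM I M)
          = (\<Prod>j\<in>J. \<integral>\<^sup>+t. g j t \<partial>M j) * (\<Prod>j\<in>I-J. emeasure (M j) ((X(i := A)) j))"
        using insert.prems set i by (intro insert.IH) auto
      moreover have "(\<Prod>j\<in>I-J. indicator ((X(i := A)) j) (z j)) =
          indicator A (z i) * (\<Prod>j\<in>I-insert i J. indicator (X j) (z j) :: ennreal)" for z
        unfolding i(4) using I by (subst prod.insert) (auto intro!: prod.cong)
      moreover have "(\<Prod>j\<in>I-J. emeasure (M j) ((X(i := A)) j)) =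
          emeasure (M i) A * (\<Prod>j\<in>I-insert i J. emeasure (M j) (X j))"
        unfolding i(4) using I by (subst prod.insert) (auto intro!: prod.cong)
      ultimately show ?case using set by (simp add: G_def C_def mult_ac)
    next
      case (mult u c)
      then show ?case
        using comp[OF i(1) mult.hyps(2)] by (simp add: nn_integral_cmult mult.assoc)
    next
      case (add u v)
      note [measurable] = comp[OF i(1) add.hyps(1)] comp[OF i(1) add.hyps(3)]
      show ?case
        using add by (simp add: nn_integral_add distrib_right)
    next
      case (seq U)
      note [measurable] = comp[OF i(1) seq.hyps(1)]
      have "(\<integral>\<^sup>+z. (SUP k. U k) (z i) * G z \<partial>PiM I M) = (\<integral>\<^sup>+z. (SUP k. U k (z i) * G z) \<partial>PiM I M)"
        by (simp add: SUP_mult_right_ennreal SUP_apply image_comp)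
      also have "\<dots> = (SUP k. \<integral>\<^sup>+z. U k (z i) * G z \<partial>PiM I M)"
        using seq.hyps(3) by (intro nn_integral_monotone_convergence_SUP)
          (auto simp: incseq_def le_fun_def intro!: mult_right_mono)
      also have "\<dots> = (SUP k. \<integral>\<^sup>+t. U k t \<partial>M i) * C"
        by (simp add: seq.IH SUP_mult_right_ennreal)
      also have "(SUP k. \<integral>\<^sup>+t. U k t \<partial>M i) = (\<integral>\<^sup>+t. (SUP k. U k) t \<partial>M i)"
        using seq.hyps(1,3) by (simp add: nn_integral_monotone_convergence_SUP image_comp)
      finally show ?case .
    qed
    from this[OF g[OF i(1)]] show ?case
      using insert.hyps by (simp add: G_def C_def mult_ac)
  qed
  from this[of I "\<lambda>i. space (M i)"] show ?thesis by simp
qed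


subsection \<open>Polynomials with non-negative coefficients\<close>

definition nonneg_poly :: "'y mpoly \<Rightarrow> bool" where
  "nonneg_poly p \<longleftrightarrow> (\<forall>\<mu>. 0 \<le> Poly_Mapping.lookup p \<mu>)"

text \<open>Writing the convolution as a finite sum over both supports makes sign arguments for
  single terms available.\<close>

lemma lookup_mult_keys:
  fixes p q :: "'y mpoly"
  shows "Poly_Mapping.lookup (p * q) \<mu> =
    (\<Sum>(a, b)\<in>Poly_Mapping.keys p \<times> Poly_Mapping.keys q.
      if \<mu> = a + b then Poly_Mapping.lookup p a * Poly_Mapping.lookup q b else 0)"
proof -
  have "Poly_Mapping.lookup (p * q) \<mu> =
    (\<Sum>a\<in>Poly_Mapping.keys p. Poly_Mapping.lookup p a * (\<Sum>b\<in>Poly_Mapping.keys q. Poly_Mapping.lookup q b when \<mu> = a + b))"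
  proof -
    have "Sum_any (\<lambda>b. Poly_Mapping.lookup q b when \<mu> = a + b) =
        (\<Sum>b\<in>Poly_Mapping.keys q. Poly_Mapping.lookup q b when \<mu> = a + b)" for a
      by (rule Sum_any.expand_superset) (auto simp: in_keys_iff)
    then show ?thesis
      unfolding lookup_mult by (subst Sum_any.expand_superset[of "Poly_Mapping.keys p"]) (auto simp: in_keys_iff)
  qed
  also have "\<dots> = (\<Sum>a\<in>Poly_Mapping.keys p. \<Sum>b\<in>Poly_Mapping.keys q.
      if \<mu> = a + b then Poly_Mapping.lookup p a * Poly_Mapping.lookup q b else 0)"
    by (auto simp: sum_distrib_left when_def intro!: sum.cong)
  finally show ?thesis by (simp add: sum.cartesian_product)
qed

lemma nonneg_poly_mult:
  assumes "nonneg_poly p" "nonneg_poly q"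
  shows "nonneg_poly (p * q)"
  using assms by (auto simp: nonneg_poly_def lookup_mult_keys intro!: sum_nonneg)

lemma nonneg_poly_single: "0 \<le> c \<Longrightarrow> nonneg_poly (Poly_Mapping.single \<mu> c)"
  by (simp add: nonneg_poly_def lookup_single when_def)

lemma nonneg_poly_sum: "(\<And>v. v \<in> A \<Longrightarrow> nonneg_poly (q v)) \<Longrightarrow> nonneg_poly (sum q A)"
  by (auto simp: nonneg_poly_def lookup_sum intro: sum_nonneg)

lemma nonneg_poly_one: "nonneg_poly 1"
  unfolding single_one[symmetric] by (rule nonneg_poly_single) simp

lemma nonneg_poly_prod: "(\<And>v. v \<in> A \<Longrightarrow> nonneg_poly (q v)) \<Longrightarrow> nonneg_poly (prod q A)"
  by (induction A rule: infinite_finite_induct)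
     (simp_all add: nonneg_poly_mult nonneg_poly_one)

text \<open>The inclusion from left to right holds for all polynomials. For the other one, the pair
  \<open>(a, b)\<close> contributes a strictly positive term that non-negative terms cannot
  cancel.\<close>

lemma keys_mult_nonneg:
  fixes p q :: "'y mpoly"
  assumes "nonneg_poly p" "nonneg_poly q"
  shows "Poly_Mapping.keys (p * q) = {a + b |a b. a \<in> Poly_Mapping.keys p \<and> b \<in> Poly_Mapping.keys q}"
proof (intro equalityI subsetI)
  show "\<mu> \<in> {a + b |a b. a \<in> Poly_Mapping.keys p \<and> b \<in> Poly_Mapping.keys q}"
    if "\<mu> \<in> Poly_Mapping.keys (p * q)" for \<mu>
    using that keys_mult[of p q] by auto
  fix \<mu> assume "\<mu> \<in> {a + b |a b. a \<in> Poly_Mapping.keys p \<and> b \<in> Poly_Mapping.keys q}"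
  then obtain a b where ab: "\<mu> = a + b" "a \<in> Poly_Mapping.keys p" "b \<in> Poly_Mapping.keys q"
    by blast
  have "0 < Poly_Mapping.lookup p a * Poly_Mapping.lookup q b"
    using ab assms by (auto simp: in_keys_iff nonneg_poly_def less_le)
  then have "0 < Poly_Mapping.lookup (p * q) \<mu>"
    unfolding lookup_mult_keys using ab assms
    by (intro sum_pos2[of _ "(a, b)"]) (auto simp: nonneg_poly_def)
  then show "\<mu> \<in> Poly_Mapping.keys (p * q)" by (simp add: in_keys_iff)
qed

lemma keys_sum_nonneg:
  fixes q :: "'v \<Rightarrow> 'y mpoly"
  assumes "finite A" "\<And>v. v \<in> A \<Longrightarrow> nonneg_poly (q v)"
  shows "Poly_Mapping.keys (sum q A) = (\<Union>v\<in>A. Poly_Mapping.keys (q v))"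
proof -
  have "Poly_Mapping.lookup (sum q A) \<mu> = 0 \<longleftrightarrow> (\<forall>v\<in>A. Poly_Mapping.lookup (q v) \<mu> = 0)" for \<mu>
    unfolding lookup_sum using assms by (intro sum_nonneg_eq_0_iff) (auto simp: nonneg_poly_def)
  then show ?thesis by (auto simp: in_keys_iff)
qed

text \<open>The function \<open>h\<close> chooses one monomial from each factor; adding exponent
  maps multiplies the chosen monomials.\<close>

lemma keys_prod_nonneg:
  fixes q :: "'v \<Rightarrow> 'y mpoly"
  assumes "finite A" "\<And>v. v \<in> A \<Longrightarrow> nonneg_poly (q v)"
  shows "Poly_Mapping.keys (prod q A) = {sum h A |h. \<forall>v\<in>A. h v \<in> Poly_Mapping.keys (q v)}"
  using assms
proof (induction A rule: finite_induct)
  case empty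
  then show ?case by simp
next
  case (insert v A)
  have "Poly_Mapping.keys (prod q (insert v A)) =
      {a + b |a b. a \<in> Poly_Mapping.keys (q v) \<and> b \<in> {sum h A |h. \<forall>v\<in>A. h v \<in> Poly_Mapping.keys (q v)}}"
    using insert by (simp add: keys_mult_nonneg nonneg_poly_prod)
  also have "\<dots> = {sum h (insert v A) |h. \<forall>v\<in>insert v A. h v \<in> Poly_Mapping.keys (q v)}" (is "?L = ?R")
  proof (intro equalityI subsetI)
    fix \<mu> assume "\<mu> \<in> ?L"
    then obtain a h where ah: "\<mu> = a + sum h A" "a \<in> Poly_Mapping.keys (q v)"
        "\<forall>v\<in>A. h v \<in> Poly_Mapping.keys (q v)"
      by blast
    have "sum (h(v := a)) A = sum h A" using insert.hyps by (intro sum.cong) auto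
    then have "\<mu> = sum (h(v := a)) (insert v A)" using insert.hyps ah by simp
    moreover have "\<forall>w\<in>insert v A. (h(v := a)) w \<in> Poly_Mapping.keys (q w)" using ah by auto
    ultimately show "\<mu> \<in> ?R" by blast
  qed (use insert.hyps in auto)
  finally show ?case .
qed

lemma mpoly_eval_nonneg:
  assumes "nonneg_poly p" "\<And>\<mu> y. \<mu> \<in> Poly_Mapping.keys p \<Longrightarrow> y \<in> Poly_Mapping.keys \<mu> \<Longrightarrow> 0 \<le> a y"
  shows "0 \<le> mpoly_eval a p"
  using assms unfolding mpoly_eval_def nonneg_poly_def
  by (intro sum_nonneg mult_nonneg_nonneg prod_nonneg zero_le_power) auto

lemma mpoly_eval_cong:
  assumes "\<And>y. y \<in> mpoly_scope p \<Longrightarrow> a y = b y"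
  shows "mpoly_eval a p = mpoly_eval b p"
  unfolding mpoly_eval_def
  by (intro sum.cong prod.cong arg_cong2[of _ _ _ _ "(*)"] arg_cong2[of _ _ _ _ "(^)"] refl)
     (auto intro!: assms simp: mpoly_scope_def)


subsection \<open>Monomials of a circuit\<close>

text \<open>Monotonicity and non-degeneracy enter jointly, as strict positivity of the constants and
  of the weights into sum nodes.\<close>

locale nondegenerate_circuit =
  fixes Y :: "'y set" and \<Phi> :: "('v, 'y) circuit"
  assumes arithmetic: "arithmetic_circuit Y \<Phi>"
    and monotone: "monotone_circuit \<Phi>"
    and non_deg: "non_degenerate \<Phi>"
begin

lemma finite_edges: "finite (edges \<Phi>)"
  using arithmetic by (auto simp: arithmetic_circuit_def intro: finite_subset)

lemma wf_edges: "wf (edges \<Phi>)"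
  using arithmetic finite_edges by (simp add: arithmetic_circuit_def finite_acyclic_wf)

lemma finite_children: "finite (children \<Phi> u)"
  by (rule finite_subset[of _ "fst ` edges \<Phi>"]) (force simp: children_def finite_edges)+

lemma children_nodes: "v \<in> children \<Phi> u \<Longrightarrow> v \<in> nodes \<Phi>"
  using arithmetic by (auto simp: arithmetic_circuit_def children_def)

lemma edge_gate: "(v, u) \<in> edges \<Phi> \<Longrightarrow> gate_of \<Phi> u = ProdGate \<or> gate_of \<Phi> u = SumGate"
proof -
  assume vu: "(v, u) \<in> edges \<Phi>"
  then have "u \<in> nodes \<Phi>" "children \<Phi> u \<noteq> {}"
    using arithmetic by (auto simp: arithmetic_circuit_def children_def)
  then show ?thesis using arithmetic unfolding arithmetic_circuit_def by metis
qed

text \<open>Well-founded induction along the edges, split by gate. The constant case supplies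
  \<open>0 < c\<close>, so that no node computes the zero polynomial.\<close>

lemma node_induct [consumes 1, case_names var const prod sum]:
  assumes "u \<in> nodes \<Phi>"
    and "\<And>u y. u \<in> nodes \<Phi> \<Longrightarrow> gate_of \<Phi> u = VarLeaf y \<Longrightarrow> y \<in> Y \<Longrightarrow> children \<Phi> u = {} \<Longrightarrow> P u"
    and "\<And>u c. u \<in> nodes \<Phi> \<Longrightarrow> gate_of \<Phi> u = ConstLeaf c \<Longrightarrow> 0 < c \<Longrightarrow> children \<Phi> u = {} \<Longrightarrow> P u"
    and "\<And>u. u \<in> nodes \<Phi> \<Longrightarrow> gate_of \<Phi> u = ProdGate \<Longrightarrow> children \<Phi> u \<noteq> {} \<Longrightarrow>
      (\<And>v. v \<in> children \<Phi> u \<Longrightarrow> P v) \<Longrightarrow> P u"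
    and "\<And>u. u \<in> nodes \<Phi> \<Longrightarrow> gate_of \<Phi> u = SumGate \<Longrightarrow> children \<Phi> u \<noteq> {} \<Longrightarrow>
      (\<And>v. v \<in> children \<Phi> u \<Longrightarrow> P v) \<Longrightarrow> P u"
  shows "P u"
  using wf_edges assms(1)
proof (induction u rule: wf_induct_rule)
  case (less u)
  have IH: "P v" if "v \<in> children \<Phi> u" for v
    using less.IH that children_nodes by (auto simp: children_def)
  have gate: "if children \<Phi> u = {} then (\<exists>y\<in>Y. gate_of \<Phi> u = VarLeaf y) \<or> (\<exists>c. gate_of \<Phi> u = ConstLeaf c)
      else gate_of \<Phi> u = ProdGate \<or> gate_of \<Phi> u = SumGate"
    using arithmetic less.prems unfolding arithmetic_circuit_def by blast
  have const: "0 < c" if "gate_of \<Phi> u = ConstLeaf c" for c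
    using monotone non_deg less.prems that
    unfolding monotone_circuit_def non_degenerate_def by (metis order_less_le)
  show ?case
  proof (cases "children \<Phi> u = {}")
    case True
    with gate consider y where "y \<in> Y" "gate_of \<Phi> u = VarLeaf y" | c where "gate_of \<Phi> u = ConstLeaf c"
      by auto
    then show ?thesis using assms(2,3) const less.prems True by metis
  next
    case False
    then show ?thesis using assms(4,5) IH gate less.prems by metis
  qed
qed

lemma weight_pos: "v \<in> children \<Phi> u \<Longrightarrow> gate_of \<Phi> u = SumGate \<Longrightarrow> 0 < weight \<Phi> (v, u)"
  using monotone non_deg
  by (fastforce simp: monotone_circuit_def non_degenerate_def children_def less_le)

lemmas node_poly_gate = node_poly_unfold[OF arithmetic]

lemma nonneg_weighted: "c > 0 \<Longrightarrow> nonneg_poly p \<Longrightarrow> nonneg_poly (mpoly_const c * p)"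
  by (simp add: mpoly_const_def nonneg_poly_mult nonneg_poly_single)

lemma nonneg_node_poly: "u \<in> nodes \<Phi> \<Longrightarrow> nonneg_poly (node_poly \<Phi> u)"
proof (induction u rule: node_induct)
  case (prod u)
  then show ?case
    by (subst node_poly_gate) (auto intro: nonneg_poly_prod)
next
  case (sum u)
  then show ?case
    by (subst node_poly_gate) (auto intro!: nonneg_poly_sum nonneg_weighted weight_pos)
qed (simp_all add: node_poly_gate mpoly_var_def mpoly_const_def nonneg_poly_single)

lemma keys_var:
  "gate_of \<Phi> u = VarLeaf y \<Longrightarrow> Poly_Mapping.keys (node_poly \<Phi> u) = {Poly_Mapping.single y 1}"
  by (subst node_poly_gate) (simp add: mpoly_var_def)

lemma keys_const:
  "gate_of \<Phi> u = ConstLeaf c \<Longrightarrow> 0 < c \<Longrightarrow> Poly_Mapping.keys (node_poly \<Phi> u) = {0}"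
  by (subst node_poly_gate) (simp add: mpoly_const_def)

lemma keys_prod:
  assumes "gate_of \<Phi> u = ProdGate"
  shows "Poly_Mapping.keys (node_poly \<Phi> u) =
    {sum h (children \<Phi> u) |h. \<forall>v\<in>children \<Phi> u. h v \<in> Poly_Mapping.keys (node_poly \<Phi> v)}"
  using assms
  by (subst node_poly_gate) (simp add: keys_prod_nonneg finite_children nonneg_node_poly children_nodes)

text \<open>Scaling by a positive weight keeps every monomial, and the scaled children cannot cancel
  each other.\<close>

lemma keys_sum:
  assumes "gate_of \<Phi> u = SumGate"
  shows "Poly_Mapping.keys (node_poly \<Phi> u) = (\<Union>v\<in>children \<Phi> u. Poly_Mapping.keys (node_poly \<Phi> v))"
proof -
  have "Poly_Mapping.keys (mpoly_const (weight \<Phi> (v, u)) * node_poly \<Phi> v) = Poly_Mapping.keys (node_poly \<Phi> v)"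
    if "v \<in> children \<Phi> u" for v
  proof -
    have "0 < weight \<Phi> (v, u)" using that assms by (rule weight_pos)
    moreover from this have "nonneg_poly (mpoly_const (weight \<Phi> (v, u)))"
      by (simp add: mpoly_const_def nonneg_poly_single)
    ultimately show ?thesis
      using nonneg_node_poly[OF children_nodes[OF that]]
      by (subst keys_mult_nonneg) (auto simp: mpoly_const_def)
  qed
  moreover have "nonneg_poly (mpoly_const (weight \<Phi> (v, u)) * node_poly \<Phi> v)"
    if "v \<in> children \<Phi> u" for v
    using that assms by (intro nonneg_weighted weight_pos nonneg_node_poly children_nodes)
  ultimately show ?thesis
    using assms by (subst node_poly_gate) (simp add: keys_sum_nonneg finite_children)
qed

lemma keys_node_poly_nonempty: "u \<in> nodes \<Phi> \<Longrightarrow> Poly_Mapping.keys (node_poly \<Phi> u) \<noteq> {}"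
proof (induction u rule: node_induct)
  case (prod u)
  then obtain h where "\<forall>v\<in>children \<Phi> u. h v \<in> Poly_Mapping.keys (node_poly \<Phi> v)"
    using bchoice[of "children \<Phi> u" "\<lambda>v \<mu>. \<mu> \<in> Poly_Mapping.keys (node_poly \<Phi> v)"] by blast
  then have "sum h (children \<Phi> u) \<in> Poly_Mapping.keys (node_poly \<Phi> u)"
    unfolding keys_prod[OF prod(2)] by blast
  then show ?case by auto
qed (auto simp: keys_var keys_const keys_sum)

text \<open>A monomial of one child can be completed by monomials of its siblings, because no node
  polynomial vanishes. This yields monomials of a product node with a prescribed factor.\<close>

lemma choose_keys:
  assumes "v \<in> children \<Phi> u" "\<mu> \<in> Poly_Mapping.keys (node_poly \<Phi> v)"
  obtains h where "\<And>w. w \<in> children \<Phi> u \<Longrightarrow> h w \<in> Poly_Mapping.keys (node_poly \<Phi> w)" "h v = \<mu>"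
proof -
  have "\<forall>w\<in>children \<Phi> u. \<exists>\<mu>. \<mu> \<in> Poly_Mapping.keys (node_poly \<Phi> w)"
    using keys_node_poly_nonempty children_nodes by blast
  then obtain h where "\<forall>w\<in>children \<Phi> u. h w \<in> Poly_Mapping.keys (node_poly \<Phi> w)" by metis
  with assms show ?thesis by (intro that[of "h(v := \<mu>)"]) auto
qed

lemma monomial_vars:
  "u \<in> nodes \<Phi> \<Longrightarrow> \<mu> \<in> Poly_Mapping.keys (node_poly \<Phi> u) \<Longrightarrow> Poly_Mapping.keys \<mu> \<subseteq> Y"
proof (induction u arbitrary: \<mu> rule: node_induct)
  case (prod u)
  then obtain h where h: "\<mu> = sum h (children \<Phi> u)" "\<forall>v\<in>children \<Phi> u. h v \<in> Poly_Mapping.keys (node_poly \<Phi> v)"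
    unfolding keys_prod[OF prod(2)] by blast
  show ?case
  proof
    fix y assume "y \<in> Poly_Mapping.keys \<mu>"
    then have "(\<Sum>v\<in>children \<Phi> u. Poly_Mapping.lookup (h v) y) \<noteq> 0"
      unfolding h(1) by (simp add: in_keys_iff lookup_sum)
    then obtain v where "v \<in> children \<Phi> u" "y \<in> Poly_Mapping.keys (h v)"
      by (metis in_keys_iff sum.neutral)
    then show "y \<in> Y" using prod.IH h by blast
  qed
qed (auto simp: keys_var keys_const keys_sum)

text \<open>Along a path upwards, \<open>\<rho>\<close> collects fixed monomials of the siblings at
  product nodes; sum nodes add nothing. The point is that a single \<open>\<rho>\<close> serves all
  monomials of \<open>u\<close>.\<close>

lemma monomial_extends:
  assumes "(u, w) \<in> (edges \<Phi>)\<^sup>*"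
  shows "\<exists>\<rho>. \<forall>\<mu>\<in>Poly_Mapping.keys (node_poly \<Phi> u). \<mu> + \<rho> \<in> Poly_Mapping.keys (node_poly \<Phi> w)"
  using assms
proof (induction rule: converse_rtrancl_induct)
  case base
  show ?case by (rule exI[of _ 0]) simp
next
  case (step u v)
  then obtain \<rho> where \<rho>: "\<And>\<mu>. \<mu> \<in> Poly_Mapping.keys (node_poly \<Phi> v) \<Longrightarrow> \<mu> + \<rho> \<in> Poly_Mapping.keys (node_poly \<Phi> w)"
    by blast
  have u: "u \<in> children \<Phi> v" using step by (simp add: children_def)
  consider "gate_of \<Phi> v = ProdGate" | "gate_of \<Phi> v = SumGate" using edge_gate[OF step(1)] by blast
  then show ?case
  proof cases
    case 1
    \<comment> \<open>\<open>\<mu>0\<close> is arbitrary and serves only to obtain \<open>h\<close>: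
      its value at \<open>u\<close> is later overwritten by \<open>\<mu>\<close>, which leaves the
      sibling part independent of \<open>\<mu>\<close>.\<close>
    obtain \<mu>0 where "\<mu>0 \<in> Poly_Mapping.keys (node_poly \<Phi> u)"
      using keys_node_poly_nonempty[OF children_nodes[OF u]] by blast
    then obtain h where h: "\<And>w. w \<in> children \<Phi> v \<Longrightarrow> h w \<in> Poly_Mapping.keys (node_poly \<Phi> w)"
      using choose_keys[OF u] by blast
    have "\<mu> + (sum h (children \<Phi> v - {u}) + \<rho>) \<in> Poly_Mapping.keys (node_poly \<Phi> w)"
      if \<mu>: "\<mu> \<in> Poly_Mapping.keys (node_poly \<Phi> u)" for \<mu>
    proof -
      have "sum (h(u := \<mu>)) (children \<Phi> v - {u}) = sum h (children \<Phi> v - {u})"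
        by (intro sum.cong) auto
      then have "\<mu> + sum h (children \<Phi> v - {u}) = sum (h(u := \<mu>)) (children \<Phi> v)"
        using sum.remove[OF finite_children u, of "h(u := \<mu>)"] by simp
      also have "\<dots> \<in> Poly_Mapping.keys (node_poly \<Phi> v)"
        unfolding keys_prod[OF 1] using h \<mu> by (intro CollectI exI[of _ "h(u := \<mu>)"]) auto
      finally show ?thesis using \<rho>[of "\<mu> + sum h (children \<Phi> v - {u})"] by (simp add: add.assoc)
    qed
    then show ?thesis by blast
  next
    case 2
    then show ?thesis using \<rho> u keys_sum[OF 2] by blast
  qed
qed

lemma root: "is_root \<Phi> (circuit_root \<Phi>)"
proof -
  have "\<exists>!r. is_root \<Phi> r" using arithmetic by (simp add: arithmetic_circuit_def)
  then show ?thesis unfolding circuit_root_def by (rule theI')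
qed

lemma root_node: "circuit_root \<Phi> \<in> nodes \<Phi>"
  using root by (simp add: is_root_def)

text \<open>In a finite acyclic graph, climbing from a node to a parent must stop, and it can stop
  only at the unique root.\<close>

lemma reaches_root: "u \<in> nodes \<Phi> \<Longrightarrow> (u, circuit_root \<Phi>) \<in> (edges \<Phi>)\<^sup>*"
proof -
  have "wf ((edges \<Phi>)\<inverse>)"
    using finite_edges arithmetic by (simp add: arithmetic_circuit_def finite_acyclic_wf_converse)
  then show "u \<in> nodes \<Phi> \<Longrightarrow> (u, circuit_root \<Phi>) \<in> (edges \<Phi>)\<^sup>*"
  proof (induction u rule: wf_induct_rule)
    case (less u)
    show ?case
    proof (cases "\<exists>w. (u, w) \<in> edges \<Phi>")
      case True
      then obtain w where w: "(u, w) \<in> edges \<Phi>" by blast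
      then have "w \<in> nodes \<Phi>" using arithmetic by (auto simp: arithmetic_circuit_def)
      then show ?thesis using less.IH[of w] w by (simp add: converse_rtrancl_into_rtrancl)
    next
      case False
      then have "is_root \<Phi> u" using less.prems by (simp add: is_root_def)
      then have "u = circuit_root \<Phi>"
        using root arithmetic by (auto simp: arithmetic_circuit_def)
      then show ?thesis by simp
    qed
  qed
qed

end


subsection \<open>Block degrees\<close>

definition block_degree :: "(nat \<Rightarrow> nat) \<Rightarrow> nat \<Rightarrow> ((nat \<times> nat) \<Rightarrow>\<^sub>0 nat) \<Rightarrow> nat" where
  "block_degree m i \<mu> = (\<Sum>j=1..m i. Poly_Mapping.lookup \<mu> (i, j))"

lemma block_degree_0 [simp]: "block_degree m i 0 = 0"
  by (simp add: block_degree_def)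

lemma block_degree_add: "block_degree m i (\<mu> + \<nu>) = block_degree m i \<mu> + block_degree m i \<nu>"
  by (simp add: block_degree_def lookup_add sum.distrib)

lemma block_degree_sum: "block_degree m i (sum h A) = (\<Sum>v\<in>A. block_degree m i (h v))"
  by (simp add: block_degree_def lookup_sum sum.swap[of _ A])

lemma block_degree_single:
  assumes "(k, j) \<in> formal_vars n m"
  shows "block_degree m i (Poly_Mapping.single (k, j) 1) = (if i = k then 1 else 0)"
proof -
  have "block_degree m i (Poly_Mapping.single (k, j) 1) = (\<Sum>j'=1..m i. if j = j' then (if i = k then 1 else 0) else 0)"
    unfolding block_degree_def by (intro sum.cong) (auto simp: lookup_single when_def)
  then show ?thesis using assms by (auto simp: formal_vars_def)
qed

text \<open>The block degree sees only indices up to \<open>m i\<close>; the hypothesis excludes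
  factors beyond that range.\<close>

lemma block_degree_nonzero_iff:
  assumes "Poly_Mapping.keys \<mu> \<subseteq> formal_vars n m"
  shows "block_degree m i \<mu> \<noteq> 0 \<longleftrightarrow> (\<exists>j. (i, j) \<in> Poly_Mapping.keys \<mu>)"
proof
  assume "\<exists>j. (i, j) \<in> Poly_Mapping.keys \<mu>"
  then obtain j where "(i, j) \<in> Poly_Mapping.keys \<mu>" by blast
  moreover from this have "j \<in> {1..m i}" using assms by (auto simp: formal_vars_def)
  ultimately show "block_degree m i \<mu> \<noteq> 0" unfolding block_degree_def by (subst sum_eq_0_iff) (auto simp: in_keys_iff)
next
  assume "block_degree m i \<mu> \<noteq> 0"
  then obtain j where "Poly_Mapping.lookup \<mu> (i, j) \<noteq> 0"
    unfolding block_degree_def by (meson sum.neutral)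
  then show "\<exists>j. (i, j) \<in> Poly_Mapping.keys \<mu>" by (auto simp: in_keys_iff)
qed

locale nondegenerate_spn = nondegenerate_circuit "formal_vars n m" \<Phi>
  for n m and \<Phi> :: "('v, nat \<times> nat) circuit"
begin

lemma dependency_scope_unfold:
  "dependency_scope \<Phi> u = {i. \<exists>j. gate_of \<Phi> u = VarLeaf (i, j)} \<union> (\<Union>v\<in>children \<Phi> u. dependency_scope \<Phi> v)"
proof -
  have "(w, u) \<in> (edges \<Phi>)\<^sup>* \<longleftrightarrow> w = u \<or> (\<exists>v\<in>children \<Phi> u. (w, v) \<in> (edges \<Phi>)\<^sup>*)" for w
    by (auto simp: children_def intro: rtrancl_into_rtrancl elim: rtranclE)
  then show ?thesis by (auto simp: dependency_scope_def)
qed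

lemma dependency_scope_mono:
  "(u, w) \<in> (edges \<Phi>)\<^sup>* \<Longrightarrow> dependency_scope \<Phi> u \<subseteq> dependency_scope \<Phi> w"
  unfolding dependency_scope_def by (auto intro: rtrancl_trans)

text \<open>The syntactic scope is visible in the polynomial: by positivity a variable occurring
  below a node survives in some monomial, also through product nodes, whose other factors are
  non-zero.\<close>

lemma dependency_scope_iff_block_degree:
  "u \<in> nodes \<Phi> \<Longrightarrow>
    i \<in> dependency_scope \<Phi> u \<longleftrightarrow> (\<exists>\<mu>\<in>Poly_Mapping.keys (node_poly \<Phi> u). block_degree m i \<mu> \<noteq> 0)"
proof (induction u rule: node_induct)
  case (var u y)
  then obtain k j where y: "y = (k, j)" "(k, j) \<in> formal_vars n m" by (cases y) auto
  then have "dependency_scope \<Phi> u = {k}"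
    using var by (simp add: dependency_scope_unfold[of u])
  then show ?case
    using var y block_degree_single[OF y(2)] by (simp add: keys_var del: One_nat_def)
next
  case (const u c)
  then show ?case by (simp add: dependency_scope_unfold[of u] keys_const)
next
  case (sum u)
  then show ?case by (auto simp: dependency_scope_unfold[of u] keys_sum)
next
  case (prod u)
  have "(\<exists>\<mu>\<in>Poly_Mapping.keys (node_poly \<Phi> u). block_degree m i \<mu> \<noteq> 0) \<longleftrightarrow>
      (\<exists>v\<in>children \<Phi> u. \<exists>\<mu>\<in>Poly_Mapping.keys (node_poly \<Phi> v). block_degree m i \<mu> \<noteq> 0)" (is "?L \<longleftrightarrow> ?R")
  proof
    assume ?L
    then obtain h where "\<forall>v\<in>children \<Phi> u. h v \<in> Poly_Mapping.keys (node_poly \<Phi> v)"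
        "(\<Sum>v\<in>children \<Phi> u. block_degree m i (h v)) \<noteq> 0"
      unfolding keys_prod[OF prod(2)] by (auto simp: block_degree_sum)
    then show ?R by (meson sum.neutral)
  next
    assume ?R
    then obtain v \<mu> where v: "v \<in> children \<Phi> u" "\<mu> \<in> Poly_Mapping.keys (node_poly \<Phi> v)" "block_degree m i \<mu> \<noteq> 0"
      by blast
    obtain h where h: "\<And>w. w \<in> children \<Phi> u \<Longrightarrow> h w \<in> Poly_Mapping.keys (node_poly \<Phi> w)" "h v = \<mu>"
      using choose_keys[OF v(1,2)] by blast
    then have "block_degree m i (sum h (children \<Phi> u)) \<noteq> 0"
      using v finite_children by (auto simp: block_degree_sum)
    moreover have "sum h (children \<Phi> u) \<in> Poly_Mapping.keys (node_poly \<Phi> u)"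
      unfolding keys_prod[OF prod(2)] using h by blast
    ultimately show ?L by blast
  qed
  then show ?case using prod by (simp add: dependency_scope_unfold[of u])
qed

lemma set_scope_circuit_poly: "set_scope (circuit_poly \<Phi>) = dependency_scope \<Phi> (circuit_root \<Phi>)"
proof -
  have "block_degree m i \<mu> \<noteq> 0 \<longleftrightarrow> (\<exists>j. (i, j) \<in> Poly_Mapping.keys \<mu>)"
    if "\<mu> \<in> Poly_Mapping.keys (node_poly \<Phi> (circuit_root \<Phi>))" for i \<mu>
    using monomial_vars[OF root_node that] by (rule block_degree_nonzero_iff)
  moreover have "i \<in> set_scope (circuit_poly \<Phi>) \<longleftrightarrow>
      (\<exists>\<mu>\<in>Poly_Mapping.keys (node_poly \<Phi> (circuit_root \<Phi>)). \<exists>j. (i, j) \<in> Poly_Mapping.keys \<mu>)" for i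
    by (auto simp: set_scope_def mpoly_scope_def circuit_poly_def)
  ultimately show ?thesis
    by (intro set_eqI) (simp add: dependency_scope_iff_block_degree[OF root_node])
qed

lemma set_multilinear_iff:
  "set_multilinear m (circuit_poly \<Phi>) \<longleftrightarrow>
    (\<forall>\<mu>\<in>Poly_Mapping.keys (circuit_poly \<Phi>). \<forall>i\<in>dependency_scope \<Phi> (circuit_root \<Phi>). block_degree m i \<mu> = 1)"
  unfolding set_multilinear_def set_scope_circuit_poly block_degree_def ..

text \<open>At a sum node, completeness gives all children the scope of the node. At a product node,
  degrees add up, and decomposability lets exactly one child contribute for each \<open>i\<close> in
  the scope.\<close>

lemma block_degree_node:
  assumes dec: "decomposable \<Phi>" and compl: "complete_circuit \<Phi>"
  shows "u \<in> nodes \<Phi> \<Longrightarrow> \<mu> \<in> Poly_Mapping.keys (node_poly \<Phi> u) \<Longrightarrow>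
    block_degree m i \<mu> = (if i \<in> dependency_scope \<Phi> u then 1 else 0)"
proof (induction u arbitrary: \<mu> rule: node_induct)
  case (var u y)
  then obtain k j where y: "y = (k, j)" "(k, j) \<in> formal_vars n m" by (cases y) auto
  then have "dependency_scope \<Phi> u = {k}"
    using var by (simp add: dependency_scope_unfold[of u])
  then show ?case
    using var y block_degree_single[OF y(2)] by (simp add: keys_var del: One_nat_def)
next
  case (const u c)
  then show ?case by (simp add: dependency_scope_unfold[of u] keys_const)
next
  case (sum u)
  then obtain v where v: "v \<in> children \<Phi> u" "\<mu> \<in> Poly_Mapping.keys (node_poly \<Phi> v)"
    by (auto simp: keys_sum)
  have "dependency_scope \<Phi> w = dependency_scope \<Phi> v" if "w \<in> children \<Phi> u" for w
    using compl sum.hyps that v(1) unfolding complete_circuit_def by blast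
  then have "(\<Union>w\<in>children \<Phi> u. dependency_scope \<Phi> w) = dependency_scope \<Phi> v"
    using v(1) by blast
  then have "dependency_scope \<Phi> u = dependency_scope \<Phi> v"
    using sum.hyps by (simp add: dependency_scope_unfold[of u])
  then show ?case using sum.IH v by simp
next
  case (prod u)
  obtain h where h: "\<mu> = sum h (children \<Phi> u)" "\<forall>v\<in>children \<Phi> u. h v \<in> Poly_Mapping.keys (node_poly \<Phi> v)"
    using prod.prems unfolding keys_prod[OF prod(2)] by blast
  have deg: "block_degree m i \<mu> = (\<Sum>v\<in>children \<Phi> u. if i \<in> dependency_scope \<Phi> v then 1 else 0)"
    unfolding h(1) block_degree_sum using prod.IH h by (intro sum.cong) auto
  show ?case
  proof (cases "i \<in> dependency_scope \<Phi> u")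
    case False
    then show ?thesis using prod.hyps unfolding deg by (auto simp: dependency_scope_unfold[of u])
  next
    case True
    then obtain v where v: "v \<in> children \<Phi> u" "i \<in> dependency_scope \<Phi> v"
      using prod.hyps by (auto simp: dependency_scope_unfold[of u])
    have "i \<in> dependency_scope \<Phi> w \<longleftrightarrow> v = w" if "w \<in> children \<Phi> u" for w
      using dec prod.hyps v that unfolding decomposable_def by blast
    then have "block_degree m i \<mu> = (\<Sum>w\<in>children \<Phi> u. if v = w then 1 else 0)"
      unfolding deg by (intro sum.cong) auto
    then show ?thesis using v True finite_children by simp
  qed
qed

section \<open>From set-multilinearity back to completeness and decomposability\<close>

lemma dependency_scope_root:
  "u \<in> nodes \<Phi> \<Longrightarrow> i \<in> dependency_scope \<Phi> u \<Longrightarrow> i \<in> dependency_scope \<Phi> (circuit_root \<Phi>)"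
  using dependency_scope_mono[OF reaches_root] by blast

text \<open>The number \<open>d\<close> is the block degree of the common cofactor
  \<open>\<rho>\<close> from \<open>monomial_extends\<close>. It is the same for all monomials of
  \<open>u\<close>, so these share one block degree, which is at most 1.\<close>

lemma set_multilinear_node:
  assumes ml: "set_multilinear m (circuit_poly \<Phi>)"
    and u: "u \<in> nodes \<Phi>" and i: "i \<in> dependency_scope \<Phi> (circuit_root \<Phi>)"
  obtains d where "\<And>\<mu>. \<mu> \<in> Poly_Mapping.keys (node_poly \<Phi> u) \<Longrightarrow> block_degree m i \<mu> + d = 1"
proof -
  obtain \<rho> where \<rho>: "\<forall>\<mu>\<in>Poly_Mapping.keys (node_poly \<Phi> u). \<mu> + \<rho> \<in> Poly_Mapping.keys (circuit_poly \<Phi>)"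
    using monomial_extends[OF reaches_root[OF u]] unfolding circuit_poly_def by blast
  have "block_degree m i \<mu> + block_degree m i \<rho> = 1" if "\<mu> \<in> Poly_Mapping.keys (node_poly \<Phi> u)" for \<mu>
    using ml \<rho> that i unfolding set_multilinear_iff block_degree_add[symmetric] by blast
  then show ?thesis by (rule that)
qed

text \<open>Monomials of two children are both monomials of the sum node and hence agree in block
  degree; a non-zero degree at one child reappears at the other.\<close>

lemma set_multilinear_imp_complete:
  assumes ml: "set_multilinear m (circuit_poly \<Phi>)"
  shows "complete_circuit \<Phi>"
proof -
  have "dependency_scope \<Phi> v \<subseteq> dependency_scope \<Phi> w"
    if u: "u \<in> nodes \<Phi>" and gate: "gate_of \<Phi> u = SumGate"
      and vw: "v \<in> children \<Phi> u" "w \<in> children \<Phi> u" for u v w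
  proof
    fix i assume i: "i \<in> dependency_scope \<Phi> v"
    note nodes = vw[THEN children_nodes]
    obtain \<mu> where \<mu>: "\<mu> \<in> Poly_Mapping.keys (node_poly \<Phi> v)" "block_degree m i \<mu> \<noteq> 0"
      using i nodes dependency_scope_iff_block_degree by metis
    obtain \<nu> where \<nu>: "\<nu> \<in> Poly_Mapping.keys (node_poly \<Phi> w)"
      using nodes keys_node_poly_nonempty by blast
    obtain d where d: "\<And>\<mu>. \<mu> \<in> Poly_Mapping.keys (node_poly \<Phi> u) \<Longrightarrow> block_degree m i \<mu> + d = 1"
      using set_multilinear_node[OF ml u dependency_scope_root[OF nodes(1) i]] by blast
    have "block_degree m i \<mu> = block_degree m i \<nu>"
    proof -
      have "\<mu> \<in> Poly_Mapping.keys (node_poly \<Phi> u)" "\<nu> \<in> Poly_Mapping.keys (node_poly \<Phi> u)"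
        using \<mu>(1) \<nu> vw unfolding keys_sum[OF gate] by blast+
      from this[THEN d] show ?thesis by linarith
    qed
    then show "i \<in> dependency_scope \<Phi> w"
      using \<mu>(2) \<nu> nodes dependency_scope_iff_block_degree by metis
  qed
  then show ?thesis unfolding complete_circuit_def by (intro ballI impI equalityI) auto
qed

text \<open>If two children shared \<open>i\<close>, multiplying a monomial with a factor from block
  \<open>i\<close> of each would give the product node a monomial of block degree at least
  2.\<close>

lemma set_multilinear_imp_decomposable:
  assumes ml: "set_multilinear m (circuit_poly \<Phi>)"
  shows "decomposable \<Phi>"
proof -
  have False
    if u: "u \<in> nodes \<Phi>" and gate: "gate_of \<Phi> u = ProdGate" and vw: "v \<in> children \<Phi> u" "w \<in> children \<Phi> u" "v \<noteq> w"
      and i: "i \<in> dependency_scope \<Phi> v" "i \<in> dependency_scope \<Phi> w" for u v w i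
  proof -
    note nodes = vw(1,2)[THEN children_nodes]
    obtain \<mu> where \<mu>: "\<mu> \<in> Poly_Mapping.keys (node_poly \<Phi> v)" "block_degree m i \<mu> \<noteq> 0"
      using i nodes dependency_scope_iff_block_degree by metis
    obtain \<nu> where \<nu>: "\<nu> \<in> Poly_Mapping.keys (node_poly \<Phi> w)" "block_degree m i \<nu> \<noteq> 0"
      using i nodes dependency_scope_iff_block_degree by metis
    obtain h where h: "\<And>w. w \<in> children \<Phi> u \<Longrightarrow> h w \<in> Poly_Mapping.keys (node_poly \<Phi> w)" "h v = \<mu>"
      using choose_keys[OF vw(1) \<mu>(1)] by blast
    \<comment> \<open>The choice \<open>h\<close> already takes \<open>\<mu>\<close> at
      \<open>v\<close>; \<open>g\<close> also takes \<open>\<nu>\<close> at \<open>w\<close>, and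
      both survive because \<open>v\<close> and \<open>w\<close> differ.\<close>
    define g where "g = h(w := \<nu>)"
    have "sum g (children \<Phi> u) \<in> Poly_Mapping.keys (node_poly \<Phi> u)"
      unfolding keys_prod[OF gate] using h \<nu> by (intro CollectI exI[of _ g]) (auto simp: g_def)
    moreover obtain d where "\<And>\<mu>. \<mu> \<in> Poly_Mapping.keys (node_poly \<Phi> u) \<Longrightarrow> block_degree m i \<mu> + d = 1"
      using set_multilinear_node[OF ml u dependency_scope_root[OF nodes(1) i(1)]] by blast
    ultimately have "block_degree m i (sum g (children \<Phi> u)) + d = 1"
      by blast
    then have "(\<Sum>v\<in>children \<Phi> u. block_degree m i (g v)) \<le> 1"
      unfolding block_degree_sum by linarith
    moreover have "(\<Sum>v\<in>{v, w}. block_degree m i (g v)) \<le> (\<Sum>v\<in>children \<Phi> u. block_degree m i (g v))"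
      using vw finite_children by (intro sum_mono2) auto
    ultimately show False using \<mu> \<nu> h vw by (simp add: g_def)
  qed
  then show ?thesis unfolding decomposable_def by (intro ballI impI equalityI subsetI) auto
qed

theorem decomposable_complete_iff_set_multilinear:
  "decomposable \<Phi> \<and> complete_circuit \<Phi> \<longleftrightarrow> set_multilinear m (circuit_poly \<Phi>)"
proof
  assume dc: "decomposable \<Phi> \<and> complete_circuit \<Phi>"
  then show "set_multilinear m (circuit_poly \<Phi>)"
    unfolding set_multilinear_iff using block_degree_node[OF _ _ root_node] by (simp add: circuit_poly_def)
qed (simp add: set_multilinear_imp_complete set_multilinear_imp_decomposable)

end


subsection \<open>Validity\<close>

text \<open>Substituting \<open>s\<close> in block \<open>i\<close> and 1 elsewhere turns a
  polynomial into a univariate one whose exponents are the block degrees.\<close>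

lemma prod_power_block_degree:
  fixes s :: real
  assumes "Poly_Mapping.keys \<mu> \<subseteq> formal_vars n m"
  shows "(\<Prod>y\<in>Poly_Mapping.keys \<mu>. (if fst y = i then s else 1) ^ Poly_Mapping.lookup \<mu> y) = s ^ block_degree m i \<mu>"
proof -
  have "(\<Prod>y\<in>Poly_Mapping.keys \<mu>. (if fst y = i then s else 1) ^ Poly_Mapping.lookup \<mu> y)
      = (\<Prod>y\<in>Poly_Mapping.keys \<mu> \<union> Pair i ` {1..m i}. (if fst y = i then s else 1) ^ Poly_Mapping.lookup \<mu> y)"
    by (rule prod.mono_neutral_left) (auto simp: in_keys_iff)
  \<comment> \<open>The index set is first enlarged by the whole block \<open>i\<close> and then cut
    down to it; all factors added or removed are 1.\<close>
  also have "\<dots> = (\<Prod>y\<in>Pair i ` {1..m i}. (if fst y = i then s else 1) ^ Poly_Mapping.lookup \<mu> y)"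
    using assms by (intro prod.mono_neutral_right) (auto simp: formal_vars_def)
  also have "\<dots> = (\<Prod>j=1..m i. s ^ Poly_Mapping.lookup \<mu> (i, j))"
    by (subst prod.reindex) (auto simp: inj_on_def)
  finally show ?thesis by (simp add: block_degree_def power_sum)
qed

text \<open>Natural numbers with sum 1 consist of one 1 and zeros, so \<open>j\<close> selects the
  only factor in each block.\<close>

lemma multilinear_monomial:
  assumes "Poly_Mapping.keys \<mu> \<subseteq> formal_vars n m" "\<And>i. i \<in> {1..n} \<Longrightarrow> block_degree m i \<mu> = 1"
  obtains j where "\<And>i. i \<in> {1..n} \<Longrightarrow> (i, j i) \<in> formal_vars n m"
    "\<And>a :: nat \<times> nat \<Rightarrow> real. (\<Prod>y\<in>Poly_Mapping.keys \<mu>. a y ^ Poly_Mapping.lookup \<mu> y) = (\<Prod>i=1..n. a (i, j i))"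
proof -
  have "\<exists>j\<in>{1..m i}. Poly_Mapping.lookup \<mu> (i, j) = 1 \<and> (\<forall>k\<in>{1..m i}. j \<noteq> k \<longrightarrow> Poly_Mapping.lookup \<mu> (i, k) = 0)"
    if "i \<in> {1..n}" for i
    using assms(2)[OF that] unfolding block_degree_def by (subst (asm) sum_eq_1_iff) auto
  then obtain j where j: "\<And>i. i \<in> {1..n} \<Longrightarrow> j i \<in> {1..m i}"
      "\<And>i. i \<in> {1..n} \<Longrightarrow> Poly_Mapping.lookup \<mu> (i, j i) = 1"
      "\<And>i k. i \<in> {1..n} \<Longrightarrow> k \<in> {1..m i} \<Longrightarrow> j i \<noteq> k \<Longrightarrow> Poly_Mapping.lookup \<mu> (i, k) = 0"
    by metis
  have keys: "Poly_Mapping.keys \<mu> = (\<lambda>i. (i, j i)) ` {1..n}"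
  proof (intro equalityI subsetI)
    fix y assume y: "y \<in> Poly_Mapping.keys \<mu>"
    then obtain i k where ik: "y = (i, k)" "i \<in> {1..n}" "k \<in> {1..m i}"
      using assms(1) by (cases y) (auto simp: formal_vars_def)
    then have "k = j i" using j(3)[OF ik(2,3)] y by (auto simp: in_keys_iff)
    then show "y \<in> (\<lambda>i. (i, j i)) ` {1..n}" using ik by blast
  next
    fix y assume "y \<in> (\<lambda>i. (i, j i)) ` {1..n}"
    then obtain i where "y = (i, j i)" "i \<in> {1..n}" by blast
    then show "y \<in> Poly_Mapping.keys \<mu>" using j(2) by (simp add: in_keys_iff)
  qed
  show ?thesis
  proof
    show "(i, j i) \<in> formal_vars n m" if "i \<in> {1..n}" for i
      using j(1) that unfolding formal_vars_def by blast
    show "(\<Prod>y\<in>Poly_Mapping.keys \<mu>. a y ^ Poly_Mapping.lookup \<mu> y) = (\<Prod>i=1..n. a (i, j i))" for a :: "nat \<times> nat \<Rightarrow> real"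
      unfolding keys using j(2) by (subst prod.reindex) (auto simp: inj_on_def)
  qed
qed

lemma additive_powers_eq_1:
  fixes c :: "'a \<Rightarrow> real" and d :: "'a \<Rightarrow> nat"
  assumes "finite K" "\<And>\<mu>. \<mu> \<in> K \<Longrightarrow> 0 < c \<mu>"
    and additive: "\<And>s. 0 \<le> s \<Longrightarrow> (\<Sum>\<mu>\<in>K. c \<mu> * (2 * s) ^ d \<mu>) = 2 * (\<Sum>\<mu>\<in>K. c \<mu> * s ^ d \<mu>)"
    and "\<mu> \<in> K"
  shows "d \<mu> = 1"
proof -
  \<comment> \<open>At \<open>s = 0\<close> the value equals its own double. As
    \<open>0 ^ 0 = 1\<close>, it is the sum of the coefficients with exponent 0, so no such exponent
    occurs.\<close>
  have "(\<Sum>\<mu>\<in>K. c \<mu> * 0 ^ d \<mu>) = 0" using additive[of 0] by simp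
  then have "c \<mu> * 0 ^ d \<mu> = 0" if "\<mu> \<in> K" for \<mu>
    using assms(1,2) that by (subst (asm) sum_nonneg_eq_0_iff) (auto intro!: mult_nonneg_nonneg intro: less_imp_le)
  then have pos: "d \<mu> \<noteq> 0" if "\<mu> \<in> K" for \<mu>
    using assms(2)[OF that] that by (metis less_irrefl mult_cancel_left1 power_0)
  \<comment> \<open>At \<open>s = 1\<close> the two sides are subtracted. Since exponent 0 is
    excluded, all terms are non-negative and must vanish.\<close>
  have "(\<Sum>\<mu>\<in>K. c \<mu> * (2 ^ d \<mu> - 2)) = 0"
    using additive[of 1] by (simp add: right_diff_distrib sum_subtractf sum_distrib_right mult.commute)
  moreover have "0 \<le> c \<mu> * (2 ^ d \<mu> - 2)" if "\<mu> \<in> K" for \<mu>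
  proof -
    have "(2::real) ^ 1 \<le> 2 ^ d \<mu>" using pos[OF that] by (intro power_increasing) auto
    then show ?thesis using assms(2)[OF that] by simp
  qed
  ultimately have "c \<mu> * (2 ^ d \<mu> - 2) = 0"
    using assms(1,4) by (simp add: sum_nonneg_eq_0_iff)
  then have "(2::real) ^ d \<mu> = 2 ^ 1" using assms(2,4) by force
  then show ?thesis by (subst (asm) power_inject_exp) auto
qed

section \<open>Strong validity and set-multilinearity of the output\<close>

context nondegenerate_spn
begin

lemma
  shows nonneg_circuit_poly: "nonneg_poly (circuit_poly \<Phi>)"
    and circuit_poly_monomial_vars: "\<mu> \<in> Poly_Mapping.keys (circuit_poly \<Phi>) \<Longrightarrow> Poly_Mapping.keys \<mu> \<subseteq> formal_vars n m"
    and circuit_poly_coeff_pos: "\<mu> \<in> Poly_Mapping.keys (circuit_poly \<Phi>) \<Longrightarrow> 0 < Poly_Mapping.lookup (circuit_poly \<Phi>) \<mu>"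
proof -
  show nn: "nonneg_poly (circuit_poly \<Phi>)"
    unfolding circuit_poly_def by (rule nonneg_node_poly[OF root_node])
  show "\<mu> \<in> Poly_Mapping.keys (circuit_poly \<Phi>) \<Longrightarrow> Poly_Mapping.keys \<mu> \<subseteq> formal_vars n m"
    unfolding circuit_poly_def by (rule monomial_vars[OF root_node])
  show "\<mu> \<in> Poly_Mapping.keys (circuit_poly \<Phi>) \<Longrightarrow> 0 < Poly_Mapping.lookup (circuit_poly \<Phi>) \<mu>"
    using nn by (auto simp: nonneg_poly_def in_keys_iff less_le)
qed

text \<open>Because the root depends on every input, each monomial has exactly one function of each
  \<open>x i\<close>, so integrating out \<open>x i\<close> always replaces one factor by its
  integral.\<close>

lemma set_multilinear_imp_valid:
  assumes adm: "admissible n M m f" and ml: "set_multilinear m (circuit_poly \<Phi>)"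
    and inputs: "dependency_scope \<Phi> (circuit_root \<Phi>) = {1..n}"
  shows "valid n M f \<Phi>"
  unfolding valid_def
proof (intro allI impI)
  fix I S x
  assume I: "I \<subseteq> {1..n}" and S: "\<forall>i\<in>I. S i \<in> sets (M i)" and x: "\<forall>i\<in>{1..n} - I. x i \<in> space (M i)"
  let ?p = "circuit_poly \<Phi>"
  let ?K = "Poly_Mapping.keys ?p"
  let ?c = "Poly_Mapping.lookup ?p"
  have finI: "finite I" using I by (rule finite_subset) simp
  have "\<exists>j. (\<forall>i\<in>{1..n}. (i, j i) \<in> formal_vars n m) \<and>
      (\<forall>a::nat \<times> nat \<Rightarrow> real. (\<Prod>y\<in>Poly_Mapping.keys \<mu>. a y ^ Poly_Mapping.lookup \<mu> y) = (\<Prod>i=1..n. a (i, j i)))"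
    if "\<mu> \<in> ?K" for \<mu>
  proof -
    have "block_degree m i \<mu> = 1" if "i \<in> {1..n}" for i
      using ml that \<open>\<mu> \<in> ?K\<close> inputs unfolding set_multilinear_iff by blast
    then show ?thesis using multilinear_monomial[OF circuit_poly_monomial_vars[OF that]] by metis
  qed
  then obtain j where j: "\<And>\<mu> i. \<mu> \<in> ?K \<Longrightarrow> i \<in> {1..n} \<Longrightarrow> (i, j \<mu> i) \<in> formal_vars n m"
    and mono: "\<And>\<mu> a. \<mu> \<in> ?K \<Longrightarrow>
      (\<Prod>y\<in>Poly_Mapping.keys \<mu>. (a y :: real) ^ Poly_Mapping.lookup \<mu> y) = (\<Prod>i=1..n. a (i, j \<mu> i))"
    by metis
  have f_nonneg: "0 \<le> f i (j \<mu> i) t" if "\<mu> \<in> ?K" "i \<in> {1..n}" "t \<in> space (M i)" for \<mu> i t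
    using adm j[OF that(1,2)] that(3) unfolding admissible_def by blast
  have f_int: "integrable (M i) (f i (j \<mu> i))" if "\<mu> \<in> ?K" "i \<in> {1..n}" for \<mu> i
    using adm j[OF that] unfolding admissible_def by blast
  define b where "b \<mu> = (\<Prod>i\<in>{1..n} - I. f i (j \<mu> i) (x i))" for \<mu>
  have b: "0 \<le> ?c \<mu> * b \<mu>" if "\<mu> \<in> ?K" for \<mu>
    unfolding b_def using x f_nonneg that circuit_poly_coeff_pos[OF that]
    by (intro mult_nonneg_nonneg prod_nonneg) auto
  \<comment> \<open>\<open>b\<close> holds the fixed coordinates, and \<open>g\<close> stands for
    the entries of the blocks in \<open>I\<close>: the values at \<open>z\<close> for the integrand,
    the integrals for the right-hand side of validity.\<close>
  have eval: "mpoly_eval (\<lambda>(i, k). if i \<in> I then g i k else f i k (x i)) ?p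
      = (\<Sum>\<mu>\<in>?K. ?c \<mu> * b \<mu> * (\<Prod>i\<in>I. g i (j \<mu> i)))" for g
  proof -
    have "(\<Prod>i=1..n. (case (i, j \<mu> i) of (i, k) \<Rightarrow> if i \<in> I then g i k else f i k (x i)))
        = b \<mu> * (\<Prod>i\<in>I. g i (j \<mu> i))" for \<mu>
    proof -
      have "(\<Prod>i=1..n. (case (i, j \<mu> i) of (i, k) \<Rightarrow> if i \<in> I then g i k else f i k (x i)))
        = (\<Prod>i\<in>{1..n} - I. if i \<in> I then g i (j \<mu> i) else f i (j \<mu> i) (x i)) *
          (\<Prod>i\<in>I. if i \<in> I then g i (j \<mu> i) else f i (j \<mu> i) (x i))"
        using I by (subst prod.subset_diff[of I]) auto
      then show ?thesis by (simp add: b_def)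
    qed
    then show ?thesis
      unfolding mpoly_eval_def by (intro sum.cong refl) (simp only: mono mult.assoc)
  qed
  \<comment> \<open>Non-negativity is essential, since \<open>ennreal\<close> sends negative reals
    to 0 and only then commutes with these sums and products.\<close>
  have eval': "ennreal (mpoly_eval (\<lambda>(i, k). if i \<in> I then g i k else f i k (x i)) ?p)
      = (\<Sum>\<mu>\<in>?K. ennreal (?c \<mu> * b \<mu>) * (\<Prod>i\<in>I. ennreal (g i (j \<mu> i))))"
    if "\<And>\<mu> i. \<mu> \<in> ?K \<Longrightarrow> i \<in> I \<Longrightarrow> 0 \<le> g i (j \<mu> i)" for g
  proof -
    have "ennreal (\<Sum>\<mu>\<in>?K. ?c \<mu> * b \<mu> * (\<Prod>i\<in>I. g i (j \<mu> i))) =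
        (\<Sum>\<mu>\<in>?K. ennreal (?c \<mu> * b \<mu> * (\<Prod>i\<in>I. g i (j \<mu> i))))"
      using that b by (intro sum_ennreal[symmetric] mult_nonneg_nonneg[of "_ * _"] prod_nonneg) auto
    also have "\<dots> = (\<Sum>\<mu>\<in>?K. ennreal (?c \<mu> * b \<mu>) * (\<Prod>i\<in>I. ennreal (g i (j \<mu> i))))"
      using that b by (intro sum.cong refl) (simp add: ennreal_mult prod_nonneg prod_ennreal)
    finally show ?thesis unfolding eval .
  qed
  \<comment> \<open>The indicator of the rectangle is distributed over the coordinates, so that the
    restricted integrand is still a product of univariate functions.\<close>
  let ?h = "\<lambda>\<mu> i t. ennreal (f i (j \<mu> i) t) * indicator (S i) t"
  have h_meas: "?h \<mu> i \<in> borel_measurable (M i)" if "\<mu> \<in> ?K" "i \<in> I" for \<mu> i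
    using borel_measurable_integrable[OF f_int[OF that(1)]] that I S
    by (intro borel_measurable_times_ennreal measurable_compose[OF _ measurable_ennreal] borel_measurable_indicator) auto
  have prod_meas: "(\<lambda>z. \<Prod>i\<in>I. ?h \<mu> i (z i)) \<in> borel_measurable (PiM I M)" if "\<mu> \<in> ?K" for \<mu>
    by (intro borel_measurable_prod_ennreal measurable_compose[OF _ h_meas[OF that]] measurable_component_singleton)
  have h_int: "(\<integral>\<^sup>+t. ?h \<mu> i t \<partial>M i) = ennreal (LINT t:S i|M i. f i (j \<mu> i) t)" if "\<mu> \<in> ?K" "i \<in> I" for \<mu> i
  proof -
    have i: "i \<in> {1..n}" using I that by auto
    have int: "integrable (M i) (\<lambda>t. indicator (S i) t *\<^sub>R f i (j \<mu> i) t)"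
      using integrable_mult_indicator[OF _ f_int[OF that(1) i]] S that by blast
    have "(\<integral>\<^sup>+t. ?h \<mu> i t \<partial>M i) = (\<integral>\<^sup>+t. ennreal (indicator (S i) t *\<^sub>R f i (j \<mu> i) t) \<partial>M i)"
      by (intro nn_integral_cong) (simp add: indicator_def)
    also have "\<dots> = ennreal (\<integral>t. indicator (S i) t *\<^sub>R f i (j \<mu> i) t \<partial>M i)"
      using f_nonneg[OF that(1) i] by (intro nn_integral_eq_integral[OF int] AE_I2) (simp add: indicator_def)
    finally show ?thesis by (simp add: set_lebesgue_integral_def)
  qed
  have lint_nonneg: "0 \<le> (LINT t:S i|M i. f i (j \<mu> i) t)" if "\<mu> \<in> ?K" "i \<in> I" for \<mu> i
    unfolding set_lebesgue_integral_def using f_nonneg[OF that(1)] I that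
    by (intro Bochner_Integration.integral_nonneg) (auto simp: indicator_def)
  have "(\<integral>\<^sup>+z\<in>(\<Pi>\<^sub>E i\<in>I. S i).
      ennreal (mpoly_eval (\<lambda>(i, j). f i j (if i \<in> I then z i else x i)) ?p) \<partial>(PiM I M))
    = (\<integral>\<^sup>+z. (\<Sum>\<mu>\<in>?K. ennreal (?c \<mu> * b \<mu>) * (\<Prod>i\<in>I. ?h \<mu> i (z i))) \<partial>(PiM I M))"
  proof (rule nn_integral_cong)
    fix z assume z: "z \<in> space (PiM I M)"
    have "(\<lambda>(i, j). f i j (if i \<in> I then z i else x i)) =
        (\<lambda>(i, k). if i \<in> I then f i k (z i) else f i k (x i))"
      by auto
    moreover have "0 \<le> f i (j \<mu> i) (z i)" if "\<mu> \<in> ?K" "i \<in> I" for \<mu> i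
      using f_nonneg[OF that(1)] I that z by (auto simp: space_PiM PiE_iff)
    ultimately have "ennreal (mpoly_eval (\<lambda>(i, j). f i j (if i \<in> I then z i else x i)) ?p)
        = (\<Sum>\<mu>\<in>?K. ennreal (?c \<mu> * b \<mu>) * (\<Prod>i\<in>I. ennreal (f i (j \<mu> i) (z i))))"
      using eval'[of "\<lambda>i k. f i k (z i)"] by simp
    moreover have "indicator (\<Pi>\<^sub>E i\<in>I. S i) z = (\<Prod>i\<in>I. indicator (S i) (z i) :: ennreal)"
      using z by (intro prod_indicator_PiE[OF finI, symmetric]) (simp add: space_PiM PiE_iff)
    ultimately show "ennreal (mpoly_eval (\<lambda>(i, j). f i j (if i \<in> I then z i else x i)) ?p) * indicator (\<Pi>\<^sub>E i\<in>I. S i) z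
        = (\<Sum>\<mu>\<in>?K. ennreal (?c \<mu> * b \<mu>) * (\<Prod>i\<in>I. ?h \<mu> i (z i)))"
      by (simp add: sum_distrib_right prod.distrib mult.assoc)
  qed
  also have "\<dots> = (\<Sum>\<mu>\<in>?K. \<integral>\<^sup>+z. ennreal (?c \<mu> * b \<mu>) * (\<Prod>i\<in>I. ?h \<mu> i (z i)) \<partial>(PiM I M))"
    by (intro nn_integral_sum borel_measurable_times_ennreal borel_measurable_const prod_meas)
  also have "\<dots> = (\<Sum>\<mu>\<in>?K. ennreal (?c \<mu> * b \<mu>) * (\<integral>\<^sup>+z. (\<Prod>i\<in>I. ?h \<mu> i (z i)) \<partial>(PiM I M)))"
    by (intro sum.cong refl nn_integral_cmult prod_meas)
  also have "\<dots> = (\<Sum>\<mu>\<in>?K. ennreal (?c \<mu> * b \<mu>) * (\<Prod>i\<in>I. ennreal (LINT t:S i|M i. f i (j \<mu> i) t)))"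
  proof (intro sum.cong refl arg_cong2[of _ _ _ _ "(*)"])
    fix \<mu> assume \<mu>: "\<mu> \<in> ?K"
    have "(\<integral>\<^sup>+z. (\<Prod>i\<in>I. ?h \<mu> i (z i)) \<partial>(PiM I M)) = (\<Prod>i\<in>I. \<integral>\<^sup>+t. ?h \<mu> i t \<partial>M i)"
      using finI h_meas[OF \<mu>] by (rule nn_integral_PiM_prod)
    then show "(\<integral>\<^sup>+z. (\<Prod>i\<in>I. ?h \<mu> i (z i)) \<partial>(PiM I M)) =
        (\<Prod>i\<in>I. ennreal (LINT t:S i|M i. f i (j \<mu> i) t))"
      using h_int[OF \<mu>] by simp
  qed
  also have "\<dots> = ennreal (mpoly_eval
      (\<lambda>(i, j). if i \<in> I then (LINT t:S i|M i. f i j t) else f i j (x i)) ?p)"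
    using eval'[of "\<lambda>i k. LINT t:S i|M i. f i k t"] lint_nonneg by simp
  finally show "(\<integral>\<^sup>+z\<in>(\<Pi>\<^sub>E i\<in>I. S i).
      ennreal (mpoly_eval (\<lambda>(i, j). f i j (if i \<in> I then z i else x i)) ?p) \<partial>(PiM I M))
    = ennreal (mpoly_eval
      (\<lambda>(i, j). if i \<in> I then (LINT t:S i|M i. f i j t) else f i j (x i)) ?p)" .
qed

lemma strongly_valid_imp_block_degree:
  assumes sv: "strongly_valid n M m \<Phi>" and nontrivial: "\<forall>i\<in>{1..n}. nontrivial_variable (M i)"
    and i: "i \<in> {1..n}" and \<mu>: "\<mu> \<in> Poly_Mapping.keys (circuit_poly \<Phi>)"
  shows "block_degree m i \<mu> = 1"
proof -
  let ?p = "circuit_poly \<Phi>"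
  let ?K = "Poly_Mapping.keys ?p"
  define separated where "separated k A B \<longleftrightarrow> A \<in> sets (M k) \<and> B \<in> sets (M k) \<and> A \<inter> B = {} \<and>
      0 < emeasure (M k) A \<and> emeasure (M k) A < \<infinity> \<and> 0 < emeasure (M k) B \<and> emeasure (M k) B < \<infinity>" for k A B
  have "\<forall>k\<in>{1..n}. \<exists>A B. separated k A B"
    using nontrivial unfolding nontrivial_variable_def separated_def by blast
  then obtain A B where sep: "\<And>k. k \<in> {1..n} \<Longrightarrow> separated k (A k) (B k)"
    by metis
  then have AB: "A k \<in> sets (M k)" "B k \<in> sets (M k)" "A k \<inter> B k = {}"
      "0 < measure (M k) (A k)" "emeasure (M k) (A k) < \<infinity>"
      "0 < measure (M k) (B k)" "emeasure (M k) (B k) < \<infinity>" if "k \<in> {1..n}" for k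
    using that by (auto simp: separated_def measure_def enn2real_positive_iff)
  have "\<exists>t. t \<in> A k" if "k \<in> {1..n}" for k
    using AB(4)[OF that] by (cases "A k = {}") auto
  \<comment> \<open>The fixed coordinates lie in \<open>A k\<close>, where the functions
    \<open>indicator (A k)\<close> used below evaluate to 1.\<close>
  then obtain x where x: "\<And>k. k \<in> {1..n} \<Longrightarrow> x k \<in> A k" by metis
  define P where "P s = mpoly_eval (\<lambda>y. if fst y = i then s else 1) ?p" for s
  have P: "P s = (\<Sum>\<mu>\<in>?K. Poly_Mapping.lookup ?p \<mu> * s ^ block_degree m i \<mu>)" for s
    unfolding P_def mpoly_eval_def
    using prod_power_block_degree[OF circuit_poly_monomial_vars] by (intro sum.cong) auto
  have P_nonneg: "0 \<le> P s" if "0 \<le> s" for s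
    unfolding P_def using that by (intro mpoly_eval_nonneg nonneg_circuit_poly) auto
  have "P (2 * s) = 2 * P s" if s: "0 \<le> s" for s
  proof -
    \<comment> \<open>Scaled so that the integral over \<open>A i\<close> and the integral over \<open>B i\<close> are both \<open>s\<close>.\<close>
    define h where "h t = s / measure (M i) (A i) * indicator (A i) t + s / measure (M i) (B i) * indicator (B i) t" for t :: real
    \<comment> \<open>One function for the whole block \<open>i\<close> makes the polynomial depend
      on a single number. The other functions are integrable because \<open>A k\<close> has finite
      measure.\<close>
    define f where "f k (j::nat) = (if k = i then h else indicator (A k))" for k j
    have ind: "integrable (M k) (indicator (A k) :: real \<Rightarrow> real)" "integrable (M k) (indicator (B k) :: real \<Rightarrow> real)"
      if "k \<in> {1..n}" for k
      using AB that by (auto intro: integrable_real_indicator)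
    have h_int: "integrable (M i) h"
      unfolding h_def using ind[OF i] by (intro Bochner_Integration.integrable_add integrable_mult_right)
    have h_nonneg: "0 \<le> h t" for t
      unfolding h_def using s by (auto intro!: add_nonneg_nonneg mult_nonneg_nonneg)
    have adm: "admissible n M m f"
      unfolding admissible_def formal_vars_def f_def using h_int h_nonneg ind by auto
    have lint: "(LINT t:T|M i. h t) = s / measure (M i) (A i) * measure (M i) (T \<inter> A i) + s / measure (M i) (B i) * measure (M i) (T \<inter> B i)"
      if T: "T \<in> sets (M i)" for T
    proof -
      have fin: "emeasure (M i) (T \<inter> A i) < \<infinity>" "emeasure (M i) (T \<inter> B i) < \<infinity>"
        using AB(1,2,5,7)[OF i] T
        by (meson emeasure_mono inf_le2 le_less_trans)+
      then have "integrable (M i) (indicator (T \<inter> A i) :: real \<Rightarrow> real)" "integrable (M i) (indicator (T \<inter> B i) :: real \<Rightarrow> real)"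
        using AB(1,2)[OF i] T by (auto intro: integrable_real_indicator)
      moreover have "indicator T t *\<^sub>R h t =
          s / measure (M i) (A i) * indicator (T \<inter> A i) t + s / measure (M i) (B i) * indicator (T \<inter> B i) t" for t
        by (simp add: h_def indicator_def)
      ultimately show ?thesis
        using AB(1,2)[OF i] T sets.sets_into_space[of _ "M i"]
        by (simp add: set_lebesgue_integral_def Int_absorb2 sets.Int)
    qed
    \<comment> \<open>The test \<open>k \<in> {i}\<close> gives \<open>E\<close> literally the form
      of the integrand in \<open>valid\<close> for \<open>I = {i}\<close>.\<close>
    define E where "E z = ennreal (mpoly_eval (\<lambda>(k, j). f k j (if k \<in> {i} then z k else x k)) ?p)" for z
    have L: "(\<integral>\<^sup>+z\<in>(\<Pi>\<^sub>E k\<in>{i}. T). E z \<partial>(PiM {i} M)) = ennreal (P (LINT t:T|M i. h t))"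
      if T: "T \<in> sets (M i)" for T
    proof -
      have "valid n M f \<Phi>" using sv adm by (simp add: strongly_valid_def)
      moreover have "\<forall>k\<in>{1..n} - {i}. x k \<in> space (M k)"
        using x AB(1) sets.sets_into_space by blast
      ultimately have "(\<integral>\<^sup>+z\<in>(\<Pi>\<^sub>E k\<in>{i}. T). E z \<partial>(PiM {i} M)) = ennreal (mpoly_eval
          (\<lambda>(k, j). if k \<in> {i} then (LINT t:T|M k. f k j t) else f k j (x k)) ?p)"
        unfolding valid_def E_def using i T by (auto dest!: spec[of _ "{i}"] spec[of _ "\<lambda>_. T"])
      also have "mpoly_eval (\<lambda>(k, j). if k \<in> {i} then (LINT t:T|M k. f k j t) else f k j (x k)) ?p = P (LINT t:T|M i. h t)"
        unfolding P_def
      \<comment> \<open>The two assignments are compared only on variables that occur, since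
        \<open>x k\<close> is controlled only for \<open>k\<close> in \<open>{1..n}\<close>.\<close>
      proof (rule mpoly_eval_cong)
        fix y assume "y \<in> mpoly_scope ?p"
        then have "y \<in> formal_vars n m" using circuit_poly_monomial_vars by (auto simp: mpoly_scope_def)
        then show "(case y of (k, j) \<Rightarrow> if k \<in> {i} then (LINT t:T|M k. f k j t) else f k j (x k)) =
            (if fst y = i then LINT t:T|M i. h t else 1)"
          using x by (auto simp: formal_vars_def f_def)
      qed
      finally show ?thesis .
    qed
    have E_meas: "E \<in> borel_measurable (PiM {i} M)"
    proof -
      have "(\<lambda>z. f k j (if k \<in> {i} then z k else x k)) \<in> borel_measurable (PiM {i} M)" for k j
        using h_int by (auto simp: f_def intro!: measurable_compose[OF measurable_component_singleton])
      then show ?thesis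
        unfolding E_def mpoly_eval_def
        by (intro measurable_compose[OF _ measurable_ennreal] borel_measurable_sum borel_measurable_times
            borel_measurable_const borel_measurable_prod borel_measurable_power) (auto simp: case_prod_beta)
    qed
    have rect: "(\<Pi>\<^sub>E k\<in>{i}. T) \<in> sets (PiM {i} M)" if "T \<in> sets (M i)" for T
      using that by (intro sets_PiM_I_finite) auto
    have U: "A i \<union> B i \<in> sets (M i)" using AB(1,2)[OF i] by blast
    \<comment> \<open>Splitting the domain into two disjoint parts and applying validity to the
      union and to each part turns additivity of the integral into an equation for
      \<open>P\<close>.\<close>
    have "(\<integral>\<^sup>+z\<in>(\<Pi>\<^sub>E k\<in>{i}. A i \<union> B i). E z \<partial>(PiM {i} M))
        = (\<integral>\<^sup>+z. E z * indicator (\<Pi>\<^sub>E k\<in>{i}. A i) z + E z * indicator (\<Pi>\<^sub>E k\<in>{i}. B i) z \<partial>(PiM {i} M))"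
      using AB(3)[OF i] by (intro nn_integral_cong) (auto simp: indicator_def PiE_iff)
    also have "\<dots> = (\<integral>\<^sup>+z\<in>(\<Pi>\<^sub>E k\<in>{i}. A i). E z \<partial>(PiM {i} M)) + (\<integral>\<^sup>+z\<in>(\<Pi>\<^sub>E k\<in>{i}. B i). E z \<partial>(PiM {i} M))"
      using E_meas rect AB(1,2)[OF i]
      by (intro nn_integral_add borel_measurable_times_ennreal borel_measurable_indicator) auto
    finally have "ennreal (P (LINT t:A i \<union> B i|M i. h t)) = ennreal (P (LINT t:A i|M i. h t)) + ennreal (P (LINT t:B i|M i. h t))"
      using AB(1,2)[OF i] U by (simp add: L)
    moreover have "(LINT t:A i \<union> B i|M i. h t) = 2 * s" "(LINT t:A i|M i. h t) = s" "(LINT t:B i|M i. h t) = s"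
      using AB(1-4,6)[OF i] U by (simp_all add: lint Int_commute Int_absorb1 Int_absorb2)
    ultimately have "ennreal (P (2 * s)) = ennreal (P s + P s)"
      using P_nonneg[OF s] by (simp del: ennreal_plus add: ennreal_plus[symmetric])
    then show ?thesis using P_nonneg[OF s] P_nonneg[of "2 * s"] s by (subst (asm) ennreal_inj) auto
  qed
  then show ?thesis
    using additive_powers_eq_1[of ?K "Poly_Mapping.lookup ?p" "block_degree m i" \<mu>] circuit_poly_coeff_pos \<mu>
    unfolding P by simp
qed

text \<open>Validity concerns all blocks in \<open>{1..n}\<close>, set-multilinearity only those in
  the set-scope; the hypothesis on the root identifies the two.\<close>

theorem strongly_valid_iff_set_multilinear:
  assumes "dependency_scope \<Phi> (circuit_root \<Phi>) = {1..n}" "\<forall>i\<in>{1..n}. nontrivial_variable (M i)"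
  shows "strongly_valid n M m \<Phi> \<longleftrightarrow> set_multilinear m (circuit_poly \<Phi>)"
proof
  assume "strongly_valid n M m \<Phi>"
  then show "set_multilinear m (circuit_poly \<Phi>)"
    using strongly_valid_imp_block_degree assms by (simp add: set_multilinear_iff)
next
  assume "set_multilinear m (circuit_poly \<Phi>)"
  then show "strongly_valid n M m \<Phi>"
    using set_multilinear_imp_valid assms(1) by (simp add: strongly_valid_def)
qed

end

theorem theorem17:
  fixes n :: nat and M :: "nat \<Rightarrow> real measure" and m :: "nat \<Rightarrow> nat"
    and f :: "nat \<Rightarrow> nat \<Rightarrow> real \<Rightarrow> real" and \<Phi> :: "('v, nat \<times> nat) circuit"
  assumes "SPN n M m f \<Phi>"
    and "non_degenerate \<Phi>"
    and inputs: "dependency_scope \<Phi> (circuit_root \<Phi>) = {1..n}"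
    and nontrivial: "\<forall>i\<in>{1..n}. nontrivial_variable (M i)"
  shows "(strongly_valid n M m \<Phi> \<longleftrightarrow> decomposable \<Phi> \<and> complete_circuit \<Phi>) \<and>
         (decomposable \<Phi> \<and> complete_circuit \<Phi> \<longleftrightarrow> set_multilinear m (circuit_poly \<Phi>))"
proof -
  interpret nondegenerate_spn n m \<Phi>
    using assms(1,2) by unfold_locales (auto simp: SPN_def)
  show ?thesis
    using strongly_valid_iff_set_multilinear[OF inputs nontrivial] decomposable_complete_iff_set_multilinear
    by blast
qed

end
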